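(* Let $c>0$, let the problem of minimization of $R(\psi)=R(\psi;c)$ be truncatable, and let $\mathscr F$ be the set of all stopping rules. Then a stopping rule $\psi$ satisfies $$R(\psi)=\inf_{\psi'\in\mathscr F}R(\psi')$$ if and only if $$I_{\{l_n<Q_n\}}\leq\psi_n\leq I_{\{l_n\leq Q_n\}}$$ $\mu^n$-almost everywhere on $T_n^\psi$ for all $n=1,2,\dots$.
   Context: Setting. $X_1,X_2,\dots$ is a discrete-time stochastic process whose distribution $P_\theta$ (expectation $E_\theta$) depends on an unknown parameter $\theta\in\Theta$. For every $n\ge1$, $(X_1,\dots,X_n)$ has under $P_\theta$ a density $f_\theta^n=f_\theta^n(x_1,\dots,x_n)$ with respect to the product measure $\mu^n=\mu\otimes\cdots\otimes\mu$, where $\mu$ is a $\sigma$-finite measure; $f_\theta^n(x_1,\dots,x_n)$ is measurable in $(\theta,x_1,\dots,x_n)$. A (randomized) stopping rule is a sequence $\psi=(\psi_1,\psi_2,\dots)$ of measurable functions $\psi_n=\psi_n(x_1,\dots,x_n)\in[0,1]$; a decision function based on $n$ observations is a measurable function $\delta_n=\delta_n(x_1,\dots,x_n)\in\mathscr D$ ($\mathscr D$ is the decision space). Under an expectation sign a function $F_n$ of $(x_1,\dots,x_n)$ is evaluated at $(X_1,\dots,X_n)$. The randomized stopping time $\tau_\psi$ satisfies: $\tau_\psi=n$ iff $U_1>\psi_1(X_1),\dots,U_{n-1}>\psi_{n-1}(X_1,\dots,X_{n-1})$ and $U_n\le\psi_n(X_1,\dots,X_n)$, where $U_1,U_2,\dots$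 are i.i.d. uniform on $[0,1]$, independent of $(X_1,X_2,\dots)$. $w(\theta,d)\ge0$ is a loss function measurable in $(\theta,d)\in\Theta\times\mathscr D$; $\pi_1,\pi_2$ are probability measures on $\Theta$ (possibly different). For every $n\ge1$ it is assumed that there is a (Bayesian) decision function $\delta_n^B$ such that for any $d\in\mathscr D$ $$\int w(\theta,d)f_\theta^n\,d\pi_1(\theta)\ge l_n:=\int w(\theta,\delta_n^B)f_\theta^n\,d\pi_1(\theta)$$ for $\mu^n$-almost all $(x_1,\dots,x_n)$. It is assumed that $\int l_1\,d\mu<\infty$. Notation: $f^n=f^n(x_1,\dots,x_n)=\int f_\theta^n\,d\pi_2(\theta)$ for $n\ge1$, $f^0\equiv1$; $s_n^\psi=(1-\psi_1)\cdots(1-\psi_{n-1})\psi_n$; $t_n^\psi=(1-\psi_1)\cdots(1-\psi_{n-1})$ with $t_1^\psi\equiv1$; $T_n^\psi=\{(x_1,\dots,x_n):t_n^\psi>0\}$; $P^{\pi_2}(\tau_\psi=n)=\int P_\theta(\tau_\psi=n)\,d\pi_2(\theta)=\int E_\theta s_n^\psi\,d\pi_2(\theta)$ and $P^{\pi_2}(\tau_\psi<\infty)=\sum_{n\ge1}P^{\pi_2}(\tau_\psi=n)$. $I_A$ is the indicator of $A$. Risk: for fixed $c>0$, $$R(\psi)=R(\psi;c)=\begin{cases}\displaystyle\sum_{n=1}^\infty\int s_n^\psi(cnf^n+l_n)\,d\mu^n,&\text{if }P^{\pi_2}(\tau_\psi<\infty)=1,\\ \infty,&\text{otherwise.}\end{cases}$$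 (This is the average cost $c\int E_\theta\tau_\psi\,d\pi_2(\theta)$ of observations plus the average loss of the procedure using $\psi$ and the Bayesian decision functions.) For $N\ge1$ the risk of $\psi$ truncated at $N$ is $$R_N(\psi)=\sum_{n=1}^{N-1}\int s_n^\psi(cnf^n+l_n)\,d\mu^n+\int t_N^\psi(cNf^N+l_N)\,d\mu^N.$$ A stopping rule $\psi$ is called truncatable if $R_N(\psi)\to R(\psi)$ as $N\to\infty$; the problem of minimization of $R(\psi)$ is called truncatable if all stopping rules are truncatable. Functions $V_n^N,Q_n^N,V_n,Q_n$: $V_N^N=l_N$, and recursively for $n=N-1,N-2,\dots,1$, $V_n^N=\min\{l_n,Q_n^N\}$, where for $n=0,1,\dots,N-1$ $$Q_n^N=Q_n^N(x_1,\dots,x_n)=cf^n(x_1,\dots,x_n)+\int V_{n+1}^N(x_1,\dots,x_{n+1})\,d\mu(x_{n+1}).$$ For each $n$, $V_n^N$ and $Q_n^N$ are nonincreasing in $N$; $V_n=\lim_{N\to\infty}V_n^N$, $Q_n=\lim_{N\to\infty}Q_n^N$. *)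

theory Defs
  imports "HOL-Probability.Probability" "HOL-Library.Extended_Nat"
begin

(* Data of a sequential decision problem: the observation space with its sigma-finite measure mu,
   the parameter space (only its sigma-algebra matters), the laws P_theta, the process X_i, the
   randomizing variables U_i, the densities f_theta^n, the decision space, the loss, the two
   priors, and the Bayesian decision functions delta_n^B.
   Indices start at 1; (x_1,...,x_n) is an extensional function on {1..n}. *)

record ('t, 'o, 'x, 'd) seq_problem =
  mu :: "'x measure"
  Par :: "'t measure"
  Law :: "'t \<Rightarrow> 'o measure"
  Obs :: "nat \<Rightarrow> 'o \<Rightarrow> 'x"
  Rnd :: "nat \<Rightarrow> 'o \<Rightarrow> real"
  dens :: "nat \<Rightarrow> 't \<Rightarrow> (nat \<Rightarrow> 'x) \<Rightarrow> real"
  Dec :: "'d measure"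
  loss :: "'t \<Rightarrow> 'd \<Rightarrow> real"
  prior1 :: "'t measure"
  prior2 :: "'t measure"
  bayes_dec :: "nat \<Rightarrow> (nat \<Rightarrow> 'x) \<Rightarrow> 'd"

definition mu_n :: "('t, 'o, 'x, 'd) seq_problem \<Rightarrow> nat \<Rightarrow> (nat \<Rightarrow> 'x) measure" where
  "mu_n S n = Pi\<^sub>M {1..n} (\<lambda>_. mu S)"

definition obs_vec :: "('t, 'o, 'x, 'd) seq_problem \<Rightarrow> nat \<Rightarrow> 'o \<Rightarrow> nat \<Rightarrow> 'x" where
  "obs_vec S n \<omega> = (\<lambda>i\<in>{1..n}. Obs S i \<omega>)"

(* l_n and f^n; the latter is the mixture over prior2, with f^0 = 1. *)

definition bayes_loss :: "('t, 'o, 'x, 'd) seq_problem \<Rightarrow> nat \<Rightarrow> (nat \<Rightarrow> 'x) \<Rightarrow> ennreal" where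
  "bayes_loss S n x =
     (\<integral>\<^sup>+ \<theta>. ennreal (loss S \<theta> (bayes_dec S n x) * dens S n \<theta> x) \<partial>prior1 S)"

definition mix_dens :: "('t, 'o, 'x, 'd) seq_problem \<Rightarrow> nat \<Rightarrow> (nat \<Rightarrow> 'x) \<Rightarrow> ennreal" where
  "mix_dens S n x = (if n = 0 then 1 else \<integral>\<^sup>+ \<theta>. ennreal (dens S n \<theta> x) \<partial>prior2 S)"

locale bayes_seq_problem =
  fixes S :: "('t, 'o, 'x, 'd) seq_problem"
  assumes sigma_finite_mu: "sigma_finite_measure (mu S)"
    and prob_Law: "\<theta> \<in> space (Par S) \<Longrightarrow> prob_space (Law S \<theta>)"
    and Obs_measurable: "\<theta> \<in> space (Par S) \<Longrightarrow> i \<ge> 1 \<Longrightarrow> Obs S i \<in> measurable (Law S \<theta>) (mu S)"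
    and dens_nonneg:
      "n \<ge> 1 \<Longrightarrow> \<theta> \<in> space (Par S) \<Longrightarrow> x \<in> space (mu_n S n) \<Longrightarrow> dens S n \<theta> x \<ge> 0"
    and dens_measurable:
      "n \<ge> 1 \<Longrightarrow> (\<lambda>(\<theta>, x). dens S n \<theta> x) \<in> borel_measurable (Par S \<Otimes>\<^sub>M mu_n S n)"
    and distributed_Obs:
      "n \<ge> 1 \<Longrightarrow> \<theta> \<in> space (Par S) \<Longrightarrow>
         distributed (Law S \<theta>) (mu_n S n) (obs_vec S n) (\<lambda>x. ennreal (dens S n \<theta> x))"
    and Rnd_indep: "\<theta> \<in> space (Par S) \<Longrightarrow> prob_space.indep_vars (Law S \<theta>) (\<lambda>_. borel) (Rnd S) {1..}"
    and Rnd_uniform: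
      "\<theta> \<in> space (Par S) \<Longrightarrow> i \<ge> 1 \<Longrightarrow> distr (Law S \<theta>) borel (Rnd S i) = uniform_measure lborel {0..1}"
    and Rnd_indep_Obs:
      "\<theta> \<in> space (Par S) \<Longrightarrow>
         prob_space.indep_set (Law S \<theta>)
           (sets (vimage_algebra (space (Law S \<theta>)) (\<lambda>\<omega>. \<lambda>i\<in>{1..}. Rnd S i \<omega>) (Pi\<^sub>M {1..} (\<lambda>_. borel))))
           (sets (vimage_algebra (space (Law S \<theta>)) (\<lambda>\<omega>. \<lambda>i\<in>{1..}. Obs S i \<omega>) (Pi\<^sub>M {1..} (\<lambda>_. mu S))))"
    and loss_nonneg: "\<theta> \<in> space (Par S) \<Longrightarrow> d \<in> space (Dec S) \<Longrightarrow> loss S \<theta> d \<ge> 0"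
    and loss_measurable: "(\<lambda>(\<theta>, d). loss S \<theta> d) \<in> borel_measurable (Par S \<Otimes>\<^sub>M Dec S)"
    and prob_prior1: "prob_space (prior1 S)" and sets_prior1: "sets (prior1 S) = sets (Par S)"
    and prob_prior2: "prob_space (prior2 S)" and sets_prior2: "sets (prior2 S) = sets (Par S)"
    and bayes_dec_measurable: "n \<ge> 1 \<Longrightarrow> bayes_dec S n \<in> measurable (mu_n S n) (Dec S)"
    and bayes_dec_optimal:
      "n \<ge> 1 \<Longrightarrow> d \<in> space (Dec S) \<Longrightarrow>
         AE x in mu_n S n.
           (\<integral>\<^sup>+ \<theta>. ennreal (loss S \<theta> d * dens S n \<theta> x) \<partial>prior1 S) \<ge> bayes_loss S n x"
    and bayes_loss_finite: "(\<integral>\<^sup>+ x. bayes_loss S 1 x \<partial>mu_n S 1) < \<infinity>"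

definition stopping_rules :: "('t, 'o, 'x, 'd) seq_problem \<Rightarrow> (nat \<Rightarrow> (nat \<Rightarrow> 'x) \<Rightarrow> real) set" where
  "stopping_rules S = {\<psi>. \<forall>n\<ge>1. \<psi> n \<in> borel_measurable (mu_n S n) \<and>
                             (\<forall>x\<in>space (mu_n S n). \<psi> n x \<in> {0..1})}"

definition t_psi :: "(nat \<Rightarrow> (nat \<Rightarrow> 'x) \<Rightarrow> real) \<Rightarrow> nat \<Rightarrow> (nat \<Rightarrow> 'x) \<Rightarrow> real" where
  "t_psi \<psi> n x = (\<Prod>k\<in>{1..<n}. 1 - \<psi> k (restrict x {1..k}))"

definition s_psi :: "(nat \<Rightarrow> (nat \<Rightarrow> 'x) \<Rightarrow> real) \<Rightarrow> nat \<Rightarrow> (nat \<Rightarrow> 'x) \<Rightarrow> real" where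
  "s_psi \<psi> n x = t_psi \<psi> n x * \<psi> n x"

definition T_psi ::
    "('t, 'o, 'x, 'd) seq_problem \<Rightarrow> (nat \<Rightarrow> (nat \<Rightarrow> 'x) \<Rightarrow> real) \<Rightarrow> nat \<Rightarrow> (nat \<Rightarrow> 'x) set" where
  "T_psi S \<psi> n = {x \<in> space (mu_n S n). t_psi \<psi> n x > 0}"

definition stop_time ::
    "('t, 'o, 'x, 'd) seq_problem \<Rightarrow> (nat \<Rightarrow> (nat \<Rightarrow> 'x) \<Rightarrow> real) \<Rightarrow> 'o \<Rightarrow> enat" where
  "stop_time S \<psi> \<omega> =
     (if \<exists>n\<ge>1. Rnd S n \<omega> \<le> \<psi> n (obs_vec S n \<omega>)
      then enat (LEAST n. n \<ge> 1 \<and> Rnd S n \<omega> \<le> \<psi> n (obs_vec S n \<omega>))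
      else \<infinity>)"

lemma stop_time_eq_iff:
  assumes "n \<ge> 1"
  shows "stop_time S \<psi> \<omega> = enat n \<longleftrightarrow>
    (\<forall>k\<in>{1..<n}. Rnd S k \<omega> > \<psi> k (obs_vec S k \<omega>)) \<and> Rnd S n \<omega> \<le> \<psi> n (obs_vec S n \<omega>)"
    (is "?L \<longleftrightarrow> ?R")
proof -
  let ?p = "\<lambda>n. n \<ge> 1 \<and> Rnd S n \<omega> \<le> \<psi> n (obs_vec S n \<omega>)"
  show ?thesis
  proof
    assume L: ?L
    then have ex: "\<exists>n. ?p n" and eq: "n = (LEAST n. ?p n)"
      by (auto simp: stop_time_def split: if_splits)
    have "?p n" unfolding eq using ex by (rule LeastI_ex)
    moreover have "\<not> ?p k" if "k < n" for k
      using that unfolding eq by (rule not_less_Least)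
    ultimately show ?R by force
  next
    assume R: ?R
    then have p: "?p n" using assms by simp
    have "(LEAST n. ?p n) = n"
      by (rule Least_equality) (use R assms in \<open>auto simp: not_less[symmetric]\<close>)
    then show ?L using p by (auto simp: stop_time_def)
  qed
qed

definition stop_prob ::
    "('t, 'o, 'x, 'd) seq_problem \<Rightarrow> (nat \<Rightarrow> (nat \<Rightarrow> 'x) \<Rightarrow> real) \<Rightarrow> nat \<Rightarrow> ennreal" where
  "stop_prob S \<psi> n =
     (\<integral>\<^sup>+ \<theta>. emeasure (Law S \<theta>) {\<omega> \<in> space (Law S \<theta>). stop_time S \<psi> \<omega> = enat n} \<partial>prior2 S)"

definition stop_prob_finite ::
    "('t, 'o, 'x, 'd) seq_problem \<Rightarrow> (nat \<Rightarrow> (nat \<Rightarrow> 'x) \<Rightarrow> real) \<Rightarrow> ennreal" where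
  "stop_prob_finite S \<psi> = (\<Sum>n. stop_prob S \<psi> (Suc n))"

definition total_cost :: "('t, 'o, 'x, 'd) seq_problem \<Rightarrow> real \<Rightarrow> nat \<Rightarrow> (nat \<Rightarrow> 'x) \<Rightarrow> ennreal" where
  "total_cost S c n x = ennreal c * of_nat n * mix_dens S n x + bayes_loss S n x"

definition risk ::
    "('t, 'o, 'x, 'd) seq_problem \<Rightarrow> real \<Rightarrow> (nat \<Rightarrow> (nat \<Rightarrow> 'x) \<Rightarrow> real) \<Rightarrow> ennreal" where
  "risk S c \<psi> =
     (if stop_prob_finite S \<psi> = 1
      then (\<Sum>n. \<integral>\<^sup>+ x. ennreal (s_psi \<psi> (Suc n) x) * total_cost S c (Suc n) x \<partial>mu_n S (Suc n))
      else \<infinity>)"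

definition risk_trunc ::
    "('t, 'o, 'x, 'd) seq_problem \<Rightarrow> real \<Rightarrow> nat \<Rightarrow> (nat \<Rightarrow> (nat \<Rightarrow> 'x) \<Rightarrow> real) \<Rightarrow> ennreal" where
  "risk_trunc S c N \<psi> =
     (\<Sum>n\<in>{1..<N}. \<integral>\<^sup>+ x. ennreal (s_psi \<psi> n x) * total_cost S c n x \<partial>mu_n S n)
     + (\<integral>\<^sup>+ x. ennreal (t_psi \<psi> N x) * total_cost S c N x \<partial>mu_n S N)"

definition truncatable_rule ::
    "('t, 'o, 'x, 'd) seq_problem \<Rightarrow> real \<Rightarrow> (nat \<Rightarrow> (nat \<Rightarrow> 'x) \<Rightarrow> real) \<Rightarrow> bool" where
  "truncatable_rule S c \<psi> \<longleftrightarrow> (\<lambda>N. risk_trunc S c N \<psi>) \<longlonglongrightarrow> risk S c \<psi>"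

definition truncatable_problem :: "('t, 'o, 'x, 'd) seq_problem \<Rightarrow> real \<Rightarrow> bool" where
  "truncatable_problem S c \<longleftrightarrow> (\<forall>\<psi>\<in>stopping_rules S. truncatable_rule S c \<psi>)"

(* V_n^N is only meaningful for 1 <= n <= N, and Q_n^N for n < N; other values play no role in the
   limits over N.  Both are nonincreasing in N, so the pointwise limit below exists in ennreal. *)

function V_trunc ::
    "('t, 'o, 'x, 'd) seq_problem \<Rightarrow> real \<Rightarrow> nat \<Rightarrow> nat \<Rightarrow> (nat \<Rightarrow> 'x) \<Rightarrow> ennreal" where
  "V_trunc S c N n x =
     (if n < N
      then min (bayes_loss S n x)
             (ennreal c * mix_dens S n x + (\<integral>\<^sup>+ y. V_trunc S c N (Suc n) (x(Suc n := y)) \<partial>mu S))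
      else bayes_loss S n x)"
  by pat_completeness auto
termination by (relation "Wellfounded.measure (\<lambda>(S, c, N, n, x). N - n)") auto

declare V_trunc.simps [simp del]

definition Q_trunc ::
    "('t, 'o, 'x, 'd) seq_problem \<Rightarrow> real \<Rightarrow> nat \<Rightarrow> nat \<Rightarrow> (nat \<Rightarrow> 'x) \<Rightarrow> ennreal" where
  "Q_trunc S c N n x =
     ennreal c * mix_dens S n x + (\<integral>\<^sup>+ y. V_trunc S c N (Suc n) (x(Suc n := y)) \<partial>mu S)"

lemma V_trunc_self: "V_trunc S c N N x = bayes_loss S N x"
  by (simp add: V_trunc.simps)

lemma V_trunc_rec: "n < N \<Longrightarrow> V_trunc S c N n x = min (bayes_loss S n x) (Q_trunc S c N n x)"
  by (subst V_trunc.simps) (simp add: Q_trunc_def)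

lemma V_trunc_antimono:
  assumes "n \<le> N"
  shows "V_trunc S c (Suc N) n x \<le> V_trunc S c N n x"
  using assms
proof (induction n arbitrary: x rule: inc_induct)
  case base
  then show ?case by (simp add: V_trunc_self V_trunc_rec)
next
  case (step n)
  then have "Q_trunc S c (Suc N) n x \<le> Q_trunc S c N n x"
    unfolding Q_trunc_def by (intro add_left_mono nn_integral_mono) auto
  with step show ?case by (simp add: V_trunc_rec min.coboundedI2)
qed

lemma Q_trunc_antimono:
  assumes "n < N"
  shows "Q_trunc S c (Suc N) n x \<le> Q_trunc S c N n x"
  unfolding Q_trunc_def using assms
  by (intro add_left_mono nn_integral_mono V_trunc_antimono) auto

definition Q_lim :: "('t, 'o, 'x, 'd) seq_problem \<Rightarrow> real \<Rightarrow> nat \<Rightarrow> (nat \<Rightarrow> 'x) \<Rightarrow> ennreal" where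
  "Q_lim S c n x = lim (\<lambda>N. Q_trunc S c N n x)"

end

theory Submission
  imports Defs
begin

text \<open>
  For a function \<open>W\<close> of the first \<open>r\<close> observations let \<open>stage_risk r W\<close> be the cost of following
  \<open>\<psi>\<close> before time \<open>r\<close> and paying \<open>c r f^r + W\<close> once time \<open>r\<close> is reached. Integrating out the last
  observation gives
  \<open>stage_risk (r + 1) W = stage_risk r (\<psi>_r l_r + (1 - \<psi>_r) (c f^r + \<integral> W d\<mu>))\<close>.
  Hence \<open>stage_risk r V_r^N\<close> increases with \<open>r\<close> from a value \<open>v_N\<close> that does not depend on \<open>\<psi>\<close> to
  \<open>R_N(\<psi>)\<close>, and the rule stopping when \<open>l_n \<le> Q_n^N\<close> attains \<open>v_N\<close>; by truncatability the
  minimal risk is \<open>v = inf v_N\<close>. If \<open>\<psi>\<close> is optimal, the increment at each stage tends to \<open>0\<close> as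
  \<open>N\<close> grows, which forces the threshold conditions. Conversely, under these conditions
  \<open>stage_risk r (min l_r Q_r)\<close> is nonincreasing in \<open>r\<close> and starts below \<open>v\<close>; this bounds the partial
  sums of the risk by \<open>v\<close> and \<open>P(\<tau> \<ge> r)\<close> by \<open>v / (c r)\<close>, so that \<open>\<psi>\<close> stops almost surely.
\<close>

section \<open>Continuation factors and the limit \<open>Q_lim\<close>\<close>

lemma t_psi_1 [simp]: "t_psi \<psi> (Suc 0) x = 1"
  by (simp add: t_psi_def)

lemma t_psi_Suc:
  assumes "n \<ge> 1"
  shows "t_psi \<psi> (Suc n) x = t_psi \<psi> n x * (1 - \<psi> n (restrict x {1..n}))"
  using assms by (simp add: t_psi_def mult.commute)

text \<open>The product stops at \<open>n - 1\<close>, so coordinate \<open>n\<close> is never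
  consulted. Hence the factor for \<open>Suc r\<close> can be pulled out of the integral over
  observation \<open>Suc r\<close>.\<close>

lemma t_psi_cong:
  assumes "\<And>i. 1 \<le> i \<Longrightarrow> i < n \<Longrightarrow> x i = y i"
  shows "t_psi \<psi> n x = t_psi \<psi> n y"
  unfolding t_psi_def
proof (intro prod.cong refl)
  fix k assume "k \<in> {1..<n}"
  then have "restrict x {1..k} = restrict y {1..k}"
    using assms by (auto simp: restrict_def fun_eq_iff)
  then show "1 - \<psi> k (restrict x {1..k}) = 1 - \<psi> k (restrict y {1..k})" by simp
qed

text \<open>Monotonicity in \<open>N\<close> starts only at \<open>Suc n\<close>, so the sequence is
  shifted before its limit is identified. The infimum form yields measurability and one-sided bounds
  without limit arguments.\<close>

lemma Q_lim_eq_INF: "Q_lim S c n x = (INF N\<in>{n<..}. Q_trunc S c N n x)"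
proof -
  define q where "q k = Q_trunc S c (k + Suc n) n x" for k
  have "decseq q"
    unfolding q_def by (intro decseq_SucI) (simp add: Q_trunc_antimono)
  then have "q \<longlonglongrightarrow> (INF k. q k)"
    by (rule LIMSEQ_INF)
  then have "(\<lambda>N. Q_trunc S c N n x) \<longlonglongrightarrow> (INF k. q k)"
    unfolding q_def by (rule LIMSEQ_offset)
  then have "Q_lim S c n x = (INF k. q k)"
    unfolding Q_lim_def by (rule limI)
  also have "range q = (\<lambda>N. Q_trunc S c N n x) ` range (\<lambda>k. k + Suc n)"
    unfolding q_def by (simp add: image_image)
  also have "range (\<lambda>k. k + Suc n) = {n<..}"
    by (auto simp: image_iff dest: less_imp_Suc_add)
  finally show ?thesis .
qed

lemma Q_lim_le_Q_trunc: "n < N \<Longrightarrow> Q_lim S c n x \<le> Q_trunc S c N n x"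
  unfolding Q_lim_eq_INF by (rule INF_lower) simp

lemma Q_trunc_antimono_le:
  assumes "n < M" "M \<le> N"
  shows "Q_trunc S c N n x \<le> Q_trunc S c M n x"
  using assms(2)
proof (induction N rule: dec_induct)
  case (step N)
  with assms(1) show ?case
    using Q_trunc_antimono[of n N S c x] by (auto intro: order_trans)
qed simp

section \<open>Convex combinations in \<open>ennreal\<close> and the uniform law\<close>

text \<open>Split \<open>b\<close> into shares \<open>p\<close> and \<open>1 - p\<close>: weight
  \<open>p\<close> on an option dearer by at least \<open>d\<close> costs at least
  \<open>p * d\<close> extra. The additive form avoids truncated subtraction.\<close>

lemma convex_le_add_gain:
  fixes a b d :: ennreal and p :: real
  assumes "b + d \<le> a" "0 \<le> p" "p \<le> 1"
  shows "b + ennreal p * d \<le> ennreal p * a + ennreal (1 - p) * b"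
proof -
  have "b + ennreal p * d = (ennreal p + ennreal (1 - p)) * b + ennreal p * d"
    using assms by (simp flip: ennreal_plus)
  also have "\<dots> = ennreal p * (b + d) + ennreal (1 - p) * b"
    by (simp add: algebra_simps)
  also have "\<dots> \<le> ennreal p * a + ennreal (1 - p) * b"
    using assms by (intro add_right_mono mult_left_mono) auto
  finally show ?thesis .
qed

lemma min_le_convex:
  fixes a b :: ennreal
  assumes "0 \<le> p" "p \<le> 1"
  shows "min a b \<le> ennreal p * a + ennreal (1 - p) * b"
proof (cases "b \<le> a")
  case True
  then show ?thesis using convex_le_add_gain[of b 0 a p] assms by (simp add: min.absorb2)
next
  case False
  then show ?thesis using convex_le_add_gain[of a 0 b "1 - p"] assms
    by (simp add: min.absorb1 add.commute)
qed

lemma emeasure_uniform_unit: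
  fixes p :: real
  assumes "0 \<le> p" "p \<le> 1"
  shows "emeasure (uniform_measure lborel {0..1}) {..p} = ennreal p"
    and "emeasure (uniform_measure lborel {0..1}) {p<..} = ennreal (1 - p)"
proof -
  have "{0..1} \<inter> {..p} = {0..p}" "{0..1} \<inter> {p<..} = {p<..1}"
    using assms by auto
  then show "emeasure (uniform_measure lborel {0..1}) {..p} = ennreal p"
    "emeasure (uniform_measure lborel {0..1}) {p<..} = ennreal (1 - p)"
    using assms by (simp_all add: divide_ennreal_def)
qed

section \<open>Iterated integrals and measurability\<close>

context bayes_seq_problem
begin

lemma product_sigma_finite_mu: "product_sigma_finite (\<lambda>_. mu S)"
  using sigma_finite_mu by (simp add: product_sigma_finite_def)

lemma sigma_finite_mu_n: "sigma_finite_measure (mu_n S n)"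
  unfolding mu_n_def
  by (rule product_sigma_finite.sigma_finite[OF product_sigma_finite_mu]) simp

lemma mu_n_Suc: "mu_n S (Suc n) = Pi\<^sub>M (insert (Suc n) {1..n}) (\<lambda>_. mu S)"
  unfolding mu_n_def by (simp add: atLeastAtMostSuc_conv)

lemma restrict_space_mu_n: "x \<in> space (mu_n S n) \<Longrightarrow> restrict x {1..n} = x"
  by (simp add: mu_n_def space_PiM PiE_restrict)

lemma restrict_measurable_mu_n [measurable]:
  "k \<le> n \<Longrightarrow> (\<lambda>x. restrict x {1..k}) \<in> measurable (mu_n S n) (mu_n S k)"
  unfolding mu_n_def by (rule measurable_restrict_subset) auto

lemma fun_upd_measurable_mu_n [measurable]:
  "(\<lambda>(x, y). x(Suc n := y)) \<in> measurable (mu_n S n \<Otimes>\<^sub>M mu S) (mu_n S (Suc n))"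
  unfolding mu_n_Suc unfolding mu_n_def by (rule measurable_add_dim)

lemma nn_integral_mu_n_Suc:
  assumes "g \<in> borel_measurable (mu_n S (Suc n))"
  shows "(\<integral>\<^sup>+ x. g x \<partial>mu_n S (Suc n)) = (\<integral>\<^sup>+ x. \<integral>\<^sup>+ y. g (x(Suc n := y)) \<partial>mu S \<partial>mu_n S n)"
  using assms unfolding mu_n_Suc unfolding mu_n_def
  by (intro product_sigma_finite.product_nn_integral_insert[OF product_sigma_finite_mu]) auto

lemma space_prior:
  "space (prior1 S) = space (Par S)" "space (prior2 S) = space (Par S)"
  using sets_eq_imp_space_eq[OF sets_prior1] sets_eq_imp_space_eq[OF sets_prior2] by auto

lemma dens_measurable_prior2:
  assumes "n \<ge> 1"
  shows "(\<lambda>(x, \<theta>). ennreal (dens S n \<theta> x)) \<in> borel_measurable (mu_n S n \<Otimes>\<^sub>M prior2 S)"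
proof -
  note [measurable_cong] = sets_prior2 and [measurable] = dens_measurable[OF assms]
  show ?thesis by measurable
qed

lemma mix_dens_measurable [measurable]: "mix_dens S n \<in> borel_measurable (mu_n S n)"
proof (cases "n = 0")
  case True
  then show ?thesis unfolding mix_dens_def by simp
next
  case False
  interpret prob_space "prior2 S" by (rule prob_prior2)
  have [measurable]: "(\<lambda>(x, \<theta>). ennreal (dens S n \<theta> x)) \<in> borel_measurable (mu_n S n \<Otimes>\<^sub>M prior2 S)"
    using False by (intro dens_measurable_prior2) simp
  show ?thesis unfolding mix_dens_def using False by simp
qed

lemma bayes_loss_measurable [measurable]:
  assumes "n \<ge> 1"
  shows "bayes_loss S n \<in> borel_measurable (mu_n S n)"
proof -
  interpret prob_space "prior1 S" by (rule prob_prior1)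
  note [measurable_cong] = sets_prior1
    and [measurable] = dens_measurable[OF assms] loss_measurable bayes_dec_measurable[OF assms]
  have "(\<lambda>(x, \<theta>). ennreal (loss S \<theta> (bayes_dec S n x) * dens S n \<theta> x))
      \<in> borel_measurable (mu_n S n \<Otimes>\<^sub>M prior1 S)"
  proof -
    have [measurable]: "(\<lambda>(x, \<theta>). loss S \<theta> (bayes_dec S n x)) \<in> borel_measurable (mu_n S n \<Otimes>\<^sub>M prior1 S)"
      using measurable_compose[of "\<lambda>(x, \<theta>). (\<theta>, bayes_dec S n x)" "mu_n S n \<Otimes>\<^sub>M prior1 S" "Par S \<Otimes>\<^sub>M Dec S", OF _ loss_measurable]
      by (simp add: case_prod_beta)
    show ?thesis by measurable
  qed
  then show ?thesis unfolding bayes_loss_def by measurable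
qed

lemma nn_integral_fun_upd_measurable:
  assumes [measurable]: "W \<in> borel_measurable (mu_n S (Suc n))"
  shows "(\<lambda>x. \<integral>\<^sup>+ y. W (x(Suc n := y)) \<partial>mu S) \<in> borel_measurable (mu_n S n)"
proof -
  interpret sigma_finite_measure "mu S" by (rule sigma_finite_mu)
  have "(\<lambda>(x, y). W (x(Suc n := y))) \<in> borel_measurable (mu_n S n \<Otimes>\<^sub>M mu S)"
    using measurable_compose[OF fun_upd_measurable_mu_n assms] by (simp add: case_prod_beta)
  then show ?thesis by measurable
qed

lemma V_trunc_measurable:
  assumes "1 \<le> n" "n \<le> N"
  shows "V_trunc S c N n \<in> borel_measurable (mu_n S n)"
  using assms(2,1)
proof (induction n rule: inc_induct)
  case base
  then show ?case by (simp add: V_trunc_self[THEN ext])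
next
  case (step n)
  then have [measurable]: "(\<lambda>x. \<integral>\<^sup>+ y. V_trunc S c N (Suc n) (x(Suc n := y)) \<partial>mu S) \<in> borel_measurable (mu_n S n)"
    by (intro nn_integral_fun_upd_measurable) simp
  show ?case
    using step by (subst V_trunc.simps[abs_def]) simp
qed

lemma Q_trunc_measurable:
  assumes "n < N"
  shows "Q_trunc S c N n \<in> borel_measurable (mu_n S n)"
  unfolding Q_trunc_def using assms
  by (intro borel_measurable_add borel_measurable_times borel_measurable_const mix_dens_measurable
      nn_integral_fun_upd_measurable V_trunc_measurable) auto

lemma Q_lim_measurable [measurable]: "Q_lim S c n \<in> borel_measurable (mu_n S n)"
  unfolding Q_lim_eq_INF
  by (intro borel_measurable_INF Q_trunc_measurable) auto

section \<open>Mixture densities as laws of the observations\<close>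

lemma expectation_obs_vec:
  assumes "n \<ge> 1" "\<theta> \<in> space (Par S)" "g \<in> borel_measurable (mu_n S n)"
  shows "(\<integral>\<^sup>+ x. ennreal (dens S n \<theta> x) * g x \<partial>mu_n S n) = (\<integral>\<^sup>+ \<omega>. g (obs_vec S n \<omega>) \<partial>Law S \<theta>)"
  using distributed_nn_integral[OF distributed_Obs] assms by blast

text \<open>Tonelli swaps parameter and observations; then \<open>dens\<close> is traded for the law
  it describes. So \<open>mix_dens\<close> is the density of the observations under the
  \<open>prior2\<close> mixture.\<close>

lemma nn_integral_mix_dens:
  assumes "n \<ge> 1" and [measurable]: "g \<in> borel_measurable (mu_n S n)"
  shows "(\<integral>\<^sup>+ x. mix_dens S n x * g x \<partial>mu_n S n)
    = (\<integral>\<^sup>+ \<theta>. \<integral>\<^sup>+ \<omega>. g (obs_vec S n \<omega>) \<partial>Law S \<theta> \<partial>prior2 S)"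
proof -
  interpret prior2: prob_space "prior2 S" by (rule prob_prior2)
  interpret pair_sigma_finite "mu_n S n" "prior2 S"
    using sigma_finite_mu_n by (simp add: pair_sigma_finite_def prior2.sigma_finite_measure_axioms)
  note [measurable] = dens_measurable_prior2[OF assms(1)]
  have "(\<integral>\<^sup>+ x. mix_dens S n x * g x \<partial>mu_n S n)
      = (\<integral>\<^sup>+ x. \<integral>\<^sup>+ \<theta>. ennreal (dens S n \<theta> x) * g x \<partial>prior2 S \<partial>mu_n S n)"
    using assms(1) by (intro nn_integral_cong) (simp add: mix_dens_def nn_integral_multc)
  also have "\<dots> = (\<integral>\<^sup>+ \<theta>. \<integral>\<^sup>+ x. ennreal (dens S n \<theta> x) * g x \<partial>mu_n S n \<partial>prior2 S)"
    by (rule Fubini'[symmetric]) measurable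
  also have "\<dots> = (\<integral>\<^sup>+ \<theta>. \<integral>\<^sup>+ \<omega>. g (obs_vec S n \<omega>) \<partial>Law S \<theta> \<partial>prior2 S)"
    using assms by (intro nn_integral_cong expectation_obs_vec) (simp_all add: space_prior)
  finally show ?thesis .
qed

text \<open>The densities for \<open>n\<close> and \<open>Suc n\<close> are linked only through the
  process: both sides are expectations of the same function of the first \<open>n\<close>
  observations.\<close>

lemma mix_dens_consistent:
  assumes "n \<ge> 1" and [measurable]: "g \<in> borel_measurable (mu_n S n)"
  shows "(\<integral>\<^sup>+ x. mix_dens S (Suc n) x * g (restrict x {1..n}) \<partial>mu_n S (Suc n))
    = (\<integral>\<^sup>+ x. mix_dens S n x * g x \<partial>mu_n S n)"
proof -
  have "restrict (obs_vec S (Suc n) \<omega>) {1..n} = obs_vec S n \<omega>" for \<omega>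
    by (auto simp: obs_vec_def fun_eq_iff)
  moreover have "(\<lambda>x. g (restrict x {1..n})) \<in> borel_measurable (mu_n S (Suc n))"
    by measurable
  ultimately show ?thesis
    using assms by (simp add: nn_integral_mix_dens)
qed

lemma nn_integral_mix_dens_1: "n \<ge> 1 \<Longrightarrow> (\<integral>\<^sup>+ x. mix_dens S n x \<partial>mu_n S n) = 1"
proof -
  assume "n \<ge> 1"
  then have "(\<integral>\<^sup>+ x. mix_dens S n x \<partial>mu_n S n) = (\<integral>\<^sup>+ \<theta>. \<integral>\<^sup>+ \<omega>. 1 \<partial>Law S \<theta> \<partial>prior2 S)"
    using nn_integral_mix_dens[of n "\<lambda>_. 1"] by simp
  also have "\<dots> = (\<integral>\<^sup>+ \<theta>. 1 \<partial>prior2 S)"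
    by (intro nn_integral_cong)
      (simp add: prob_space.emeasure_space_1[OF prob_Law] space_prior)
  also have "\<dots> = 1"
    by (simp add: prob_space.emeasure_space_1[OF prob_prior2])
  finally show ?thesis .
qed

end

subsection \<open>Risk of a rule up to a given stage\<close>

text \<open>\<open>W\<close> is what remains to be paid: the price of the first \<open>r\<close>
  observations is charged separately, so that a single further observation adds just one
  \<open>c\<close> per unit of continuing mass.\<close>

definition stage_risk ::
    "('t, 'o, 'x, 'd) seq_problem \<Rightarrow> real \<Rightarrow> (nat \<Rightarrow> (nat \<Rightarrow> 'x) \<Rightarrow> real) \<Rightarrow> nat \<Rightarrow>
      ((nat \<Rightarrow> 'x) \<Rightarrow> ennreal) \<Rightarrow> ennreal" where
  "stage_risk S c \<psi> r W =
     (\<Sum>n\<in>{1..<r}. \<integral>\<^sup>+ x. ennreal (s_psi \<psi> n x) * total_cost S c n x \<partial>mu_n S n)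
     + (\<integral>\<^sup>+ x. ennreal (t_psi \<psi> r x) * (ennreal c * of_nat r * mix_dens S r x + W x) \<partial>mu_n S r)"

lemma risk_trunc_eq_stage_risk: "risk_trunc S c N \<psi> = stage_risk S c \<psi> N (V_trunc S c N N)"
  by (simp add: risk_trunc_def stage_risk_def V_trunc_self total_cost_def)

text \<open>Where \<open>t_psi\<close> is not positive, the weight becomes \<open>0\<close> in
  \<open>ennreal\<close>. Comparison on \<open>T_psi\<close> is thus enough, which is exactly where
  the threshold conditions speak.\<close>

lemma stage_risk_mono:
  assumes "AE x in mu_n S r. t_psi \<psi> r x > 0 \<longrightarrow> W x \<le> W' x"
  shows "stage_risk S c \<psi> r W \<le> stage_risk S c \<psi> r W'"
  unfolding stage_risk_def
proof (intro add_left_mono nn_integral_mono_AE)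
  show "AE x in mu_n S r. ennreal (t_psi \<psi> r x) * (ennreal c * of_nat r * mix_dens S r x + W x)
      \<le> ennreal (t_psi \<psi> r x) * (ennreal c * of_nat r * mix_dens S r x + W' x)"
    using assms
  proof (eventually_elim)
    case (elim x)
    then show ?case
      by (cases "t_psi \<psi> r x > 0") (auto intro!: mult_left_mono add_left_mono simp: ennreal_neg)
  qed
qed

context bayes_seq_problem
begin

lemma stopping_rule_measurable:
  "\<psi> \<in> stopping_rules S \<Longrightarrow> n \<ge> 1 \<Longrightarrow> \<psi> n \<in> borel_measurable (mu_n S n)"
  by (simp add: stopping_rules_def)

lemma stopping_rule_bounds:
  assumes "\<psi> \<in> stopping_rules S" "n \<ge> 1" "x \<in> space (mu_n S n)"
  shows "0 \<le> \<psi> n x" "\<psi> n x \<le> 1"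
  using assms by (auto simp: stopping_rules_def)

text \<open>The bound is \<open>Suc m\<close> because \<open>t_psi \<psi> n\<close> uses
  \<open>n - 1\<close> observations. The recursion needs \<open>t_psi \<psi> (Suc r)\<close> over
  both \<open>mu_n S r\<close> and \<open>mu_n S (Suc r)\<close>.\<close>

lemma t_psi_measurable:
  assumes "\<psi> \<in> stopping_rules S" "n \<le> Suc m"
  shows "t_psi \<psi> n \<in> borel_measurable (mu_n S m)"
  unfolding t_psi_def
proof (intro borel_measurable_prod borel_measurable_diff borel_measurable_const)
  fix k assume "k \<in> {1..<n}"
  then show "(\<lambda>x. \<psi> k (restrict x {1..k})) \<in> borel_measurable (mu_n S m)"
    using assms by (intro measurable_compose[OF restrict_measurable_mu_n stopping_rule_measurable]) auto
qed

lemma s_psi_measurable: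
  "\<psi> \<in> stopping_rules S \<Longrightarrow> n \<ge> 1 \<Longrightarrow> s_psi \<psi> n \<in> borel_measurable (mu_n S n)"
  unfolding s_psi_def by (intro borel_measurable_times t_psi_measurable stopping_rule_measurable) auto

lemma t_psi_Suc_space:
  "n \<ge> 1 \<Longrightarrow> x \<in> space (mu_n S n) \<Longrightarrow> t_psi \<psi> (Suc n) x = t_psi \<psi> n x * (1 - \<psi> n x)"
  by (simp only: t_psi_Suc restrict_space_mu_n)

lemma ennreal_s_psi:
  assumes "\<psi> \<in> stopping_rules S" "n \<ge> 1" "x \<in> space (mu_n S n)"
  shows "ennreal (s_psi \<psi> n x) = ennreal (t_psi \<psi> n x) * ennreal (\<psi> n x)"
  unfolding s_psi_def by (intro ennreal_mult'' stopping_rule_bounds assms)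

lemma ennreal_t_psi_Suc:
  assumes "\<psi> \<in> stopping_rules S" "n \<ge> 1" "x \<in> space (mu_n S n)"
  shows "ennreal (t_psi \<psi> (Suc n) x) = ennreal (t_psi \<psi> n x) * ennreal (1 - \<psi> n x)"
  unfolding t_psi_Suc_space[OF assms(2,3)]
  using stopping_rule_bounds(2)[OF assms] by (intro ennreal_mult'') simp

text \<open>The factor depends on the first \<open>r\<close> observations alone, so consistency of
  the mixture densities integrates out the last one.\<close>

lemma nn_integral_t_psi_Suc_mix_dens:
  assumes "\<psi> \<in> stopping_rules S" "r \<ge> 1"
  shows "(\<integral>\<^sup>+ x. ennreal (t_psi \<psi> (Suc r) x) * mix_dens S (Suc r) x \<partial>mu_n S (Suc r))
    = (\<integral>\<^sup>+ x. ennreal (t_psi \<psi> r x) * ennreal (1 - \<psi> r x) * mix_dens S r x \<partial>mu_n S r)"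
proof -
  have "t_psi \<psi> (Suc r) x = t_psi \<psi> (Suc r) (restrict x {1..r})" for x
    by (rule t_psi_cong) auto
  then have "(\<integral>\<^sup>+ x. ennreal (t_psi \<psi> (Suc r) x) * mix_dens S (Suc r) x \<partial>mu_n S (Suc r))
    = (\<integral>\<^sup>+ x. mix_dens S (Suc r) x * ennreal (t_psi \<psi> (Suc r) (restrict x {1..r})) \<partial>mu_n S (Suc r))"
    by (metis mult.commute)
  also have "\<dots> = (\<integral>\<^sup>+ x. mix_dens S r x * ennreal (t_psi \<psi> (Suc r) x) \<partial>mu_n S r)"
    using assms by (intro mix_dens_consistent measurable_compose[OF t_psi_measurable measurable_ennreal]) auto
  also have "\<dots> = (\<integral>\<^sup>+ x. ennreal (t_psi \<psi> r x) * ennreal (1 - \<psi> r x) * mix_dens S r x \<partial>mu_n S r)"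
    using assms by (intro nn_integral_cong) (simp add: ennreal_t_psi_Suc mult.commute)
  finally show ?thesis .
qed

text \<open>At time \<open>r\<close> the rule either stops or buys another observation. The stopped
  part is the new summand; the sampling cost is brought back to stage \<open>r\<close> by
  consistency of the densities, and \<open>W\<close> by integrating over the last
  coordinate.\<close>

lemma stage_risk_Suc:
  assumes psi: "\<psi> \<in> stopping_rules S" and r: "r \<ge> 1"
    and W: "W \<in> borel_measurable (mu_n S (Suc r))"
  shows "stage_risk S c \<psi> (Suc r) W = stage_risk S c \<psi> r
    (\<lambda>x. ennreal (\<psi> r x) * bayes_loss S r x
      + ennreal (1 - \<psi> r x) * (ennreal c * mix_dens S r x + (\<integral>\<^sup>+ y. W (x(Suc r := y)) \<partial>mu S)))"
proof -
  define w where "w x = (\<integral>\<^sup>+ y. W (x(Suc r := y)) \<partial>mu S)" for x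
  let ?t = "\<lambda>x. ennreal (t_psi \<psi> r x)" and ?p = "\<lambda>x. ennreal (\<psi> r x)"
    and ?q = "\<lambda>x. ennreal (1 - \<psi> r x)" and ?f = "mix_dens S r" and ?l = "bayes_loss S r"
  have [measurable]: "\<psi> r \<in> borel_measurable (mu_n S r)"
    "t_psi \<psi> r \<in> borel_measurable (mu_n S r)"
    "t_psi \<psi> (Suc r) \<in> borel_measurable (mu_n S r)"
    "t_psi \<psi> (Suc r) \<in> borel_measurable (mu_n S (Suc r))"
    "w \<in> borel_measurable (mu_n S r)" "?l \<in> borel_measurable (mu_n S r)"
    "mix_dens S r \<in> borel_measurable (mu_n S r)"
    unfolding w_def using psi r W
    by (auto intro: t_psi_measurable stopping_rule_measurable nn_integral_fun_upd_measurable bayes_loss_measurable)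
  note [measurable] = W
  have stop: "(\<integral>\<^sup>+ x. ennreal (s_psi \<psi> r x) * total_cost S c r x \<partial>mu_n S r)
      = (\<integral>\<^sup>+ x. ?t x * ?p x * (ennreal c * of_nat r * ?f x + ?l x) \<partial>mu_n S r)"
    using psi r by (intro nn_integral_cong) (simp add: ennreal_s_psi total_cost_def)
  have cost: "(\<integral>\<^sup>+ x. ennreal (t_psi \<psi> (Suc r) x) * (ennreal c * of_nat (Suc r) * mix_dens S (Suc r) x) \<partial>mu_n S (Suc r))
      = (\<integral>\<^sup>+ x. ennreal c * of_nat (Suc r) * (?t x * ?q x * ?f x) \<partial>mu_n S r)"
  proof -
    have "(\<integral>\<^sup>+ x. ennreal (t_psi \<psi> (Suc r) x) * (ennreal c * of_nat (Suc r) * mix_dens S (Suc r) x) \<partial>mu_n S (Suc r))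
      = (\<integral>\<^sup>+ x. ennreal c * of_nat (Suc r) * (ennreal (t_psi \<psi> (Suc r) x) * mix_dens S (Suc r) x) \<partial>mu_n S (Suc r))"
      by (simp only: mult_ac)
    also have "\<dots> = ennreal c * of_nat (Suc r) *
        (\<integral>\<^sup>+ x. ennreal (t_psi \<psi> (Suc r) x) * mix_dens S (Suc r) x \<partial>mu_n S (Suc r))"
      by (rule nn_integral_cmult) measurable
    also have "\<dots> = ennreal c * of_nat (Suc r) * (\<integral>\<^sup>+ x. ?t x * ?q x * ?f x \<partial>mu_n S r)"
      unfolding nn_integral_t_psi_Suc_mix_dens[OF psi r] ..
    also have "\<dots> = (\<integral>\<^sup>+ x. ennreal c * of_nat (Suc r) * (?t x * ?q x * ?f x) \<partial>mu_n S r)"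
      by (rule nn_integral_cmult[symmetric]) measurable
    finally show ?thesis .
  qed
  have loss: "(\<integral>\<^sup>+ x. ennreal (t_psi \<psi> (Suc r) x) * W x \<partial>mu_n S (Suc r))
      = (\<integral>\<^sup>+ x. ?t x * ?q x * w x \<partial>mu_n S r)"
  proof -
    have "t_psi \<psi> (Suc r) (x(Suc r := y)) = t_psi \<psi> (Suc r) x" for x y
      by (rule t_psi_cong) auto
    moreover have "(\<integral>\<^sup>+ y. ennreal (t_psi \<psi> (Suc r) x) * W (x(Suc r := y)) \<partial>mu S)
        = ?t x * ?q x * w x" if "x \<in> space (mu_n S r)" for x
    proof -
      have "(\<lambda>y. W (x(Suc r := y))) \<in> borel_measurable (mu S)"
        using measurable_compose[OF measurable_Pair1'[OF that, of "mu S"]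
            measurable_compose[OF fun_upd_measurable_mu_n W]]
        by simp
      then show ?thesis
        using psi r that by (simp add: nn_integral_cmult w_def ennreal_t_psi_Suc)
    qed
    ultimately show ?thesis
      by (subst nn_integral_mu_n_Suc) (auto intro!: nn_integral_cong)
  qed
  have "stage_risk S c \<psi> (Suc r) W =
    (\<Sum>n\<in>{1..<r}. \<integral>\<^sup>+ x. ennreal (s_psi \<psi> n x) * total_cost S c n x \<partial>mu_n S n)
    + ((\<integral>\<^sup>+ x. ?t x * ?p x * (ennreal c * of_nat r * ?f x + ?l x) \<partial>mu_n S r)
      + ((\<integral>\<^sup>+ x. ennreal c * of_nat (Suc r) * (?t x * ?q x * ?f x) \<partial>mu_n S r)
        + (\<integral>\<^sup>+ x. ?t x * ?q x * w x \<partial>mu_n S r)))"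
  proof -
    have "(\<integral>\<^sup>+ x. ennreal (t_psi \<psi> (Suc r) x) * (ennreal c * of_nat (Suc r) * mix_dens S (Suc r) x + W x) \<partial>mu_n S (Suc r))
      = (\<integral>\<^sup>+ x. ennreal (t_psi \<psi> (Suc r) x) * (ennreal c * of_nat (Suc r) * mix_dens S (Suc r) x) \<partial>mu_n S (Suc r))
      + (\<integral>\<^sup>+ x. ennreal (t_psi \<psi> (Suc r) x) * W x \<partial>mu_n S (Suc r))"
      unfolding distrib_left by (rule nn_integral_add) measurable
    then show ?thesis
      using r unfolding stage_risk_def cost[symmetric] loss[symmetric] stop[symmetric]
      by (simp only: sum.atLeastLessThan_Suc add.assoc)
  qed
  also have "\<dots> = (\<Sum>n\<in>{1..<r}. \<integral>\<^sup>+ x. ennreal (s_psi \<psi> n x) * total_cost S c n x \<partial>mu_n S n)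
    + (\<integral>\<^sup>+ x. ?t x * ?p x * (ennreal c * of_nat r * ?f x + ?l x)
      + (ennreal c * of_nat (Suc r) * (?t x * ?q x * ?f x) + ?t x * ?q x * w x) \<partial>mu_n S r)"
    by (subst nn_integral_add, measurable)+
  also have "(\<integral>\<^sup>+ x. ?t x * ?p x * (ennreal c * of_nat r * ?f x + ?l x)
      + (ennreal c * of_nat (Suc r) * (?t x * ?q x * ?f x) + ?t x * ?q x * w x) \<partial>mu_n S r)
    = (\<integral>\<^sup>+ x. ?t x * (ennreal c * of_nat r * ?f x
      + (?p x * ?l x + ?q x * (ennreal c * ?f x + w x))) \<partial>mu_n S r)"
  proof (rule nn_integral_cong)
    fix x assume "x \<in> space (mu_n S r)"
    \<comment> \<open>Writing \<open>1\<close> as \<open>?p x + ?q x\<close> shares the price of the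
      first \<open>r\<close> observations between stopping and continuing.\<close>
    then have "?p x + ?q x = 1"
      using stopping_rule_bounds[OF psi r, of x] by (simp flip: ennreal_plus)
    then have "?t x * (ennreal c * of_nat r * ?f x + (?p x * ?l x + ?q x * (ennreal c * ?f x + w x)))
      = ?t x * ((?p x + ?q x) * (ennreal c * of_nat r * ?f x)
        + (?p x * ?l x + ?q x * (ennreal c * ?f x + w x)))"
      by simp
    also have "\<dots> = ?t x * ?p x * (ennreal c * of_nat r * ?f x + ?l x)
      + (ennreal c * of_nat (Suc r) * (?t x * ?q x * ?f x) + ?t x * ?q x * w x)"
      by (simp add: algebra_simps)
    finally show "?t x * ?p x * (ennreal c * of_nat r * ?f x + ?l x)
      + (ennreal c * of_nat (Suc r) * (?t x * ?q x * ?f x) + ?t x * ?q x * w x)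
      = ?t x * (ennreal c * of_nat r * ?f x + (?p x * ?l x + ?q x * (ennreal c * ?f x + w x)))"
      by (rule sym)
  qed
  finally show ?thesis
    unfolding stage_risk_def w_def .
qed

lemma stage_risk_1:
  assumes "W \<in> borel_measurable (mu_n S 1)"
  shows "stage_risk S c \<psi> 1 W = ennreal c + (\<integral>\<^sup>+ x. W x \<partial>mu_n S 1)"
  using assms nn_integral_mix_dens_1[of 1]
  by (simp add: stage_risk_def nn_integral_add nn_integral_cmult)

subsection \<open>The minimal risk\<close>

definition value_trunc :: "real \<Rightarrow> nat \<Rightarrow> ennreal" where
  "value_trunc c N = ennreal c + (\<integral>\<^sup>+ x. V_trunc S c N 1 x \<partial>mu_n S 1)"

lemma stage_risk_Suc_V_trunc:
  assumes "\<psi> \<in> stopping_rules S" "1 \<le> r" "r < N"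
  shows "stage_risk S c \<psi> (Suc r) (V_trunc S c N (Suc r)) = stage_risk S c \<psi> r
    (\<lambda>x. ennreal (\<psi> r x) * bayes_loss S r x + ennreal (1 - \<psi> r x) * Q_trunc S c N r x)"
  using assms by (subst stage_risk_Suc) (auto intro: V_trunc_measurable simp: Q_trunc_def)

text \<open>\<open>V_trunc\<close> is the minimum of stopping and continuing, while
  \<open>\<psi>\<close> pays a convex combination of the two, so no stage can lower the
  total.\<close>

lemma stage_risk_V_trunc_mono:
  assumes psi: "\<psi> \<in> stopping_rules S" and "1 \<le> r" "r \<le> m" "m \<le> N"
  shows "stage_risk S c \<psi> r (V_trunc S c N r) \<le> stage_risk S c \<psi> m (V_trunc S c N m)"
  using assms(3,4)
proof (induction m rule: dec_induct)
  case (step m)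
  have "stage_risk S c \<psi> m (V_trunc S c N m) \<le> stage_risk S c \<psi> (Suc m) (V_trunc S c N (Suc m))"
    using step \<open>1 \<le> r\<close> psi unfolding stage_risk_Suc_V_trunc[OF psi order_trans[OF \<open>1 \<le> r\<close> step(1)] Suc_le_lessD[OF step(4)]]
    by (intro stage_risk_mono AE_I2)
      (auto simp: V_trunc_rec intro!: min_le_convex stopping_rule_bounds)
  with step show ?case by auto
qed simp

lemma stage_risk_1_V_trunc:
  "1 \<le> N \<Longrightarrow> stage_risk S c \<psi> 1 (V_trunc S c N 1) = value_trunc c N"
  unfolding value_trunc_def by (intro stage_risk_1 V_trunc_measurable) auto

text \<open>Defined by backward induction alone, over horizons instead of rules; truncatability
  later identifies it with the minimal risk.\<close>

definition opt_value :: "real \<Rightarrow> ennreal" where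
  "opt_value c = (INF N\<in>{1..}. value_trunc c N)"

lemma opt_value_le: "1 \<le> N \<Longrightarrow> opt_value c \<le> value_trunc c N"
  unfolding opt_value_def by (rule INF_lower) simp

text \<open>Horizon \<open>1\<close> costs \<open>c\<close> plus the integral of \<open>l_1\<close>.
  Finiteness serves twice: to cancel \<open>opt_value\<close> in an inequality and to bound the
  tails of the stopping time.\<close>

lemma opt_value_finite: "opt_value c < \<infinity>"
proof -
  have "opt_value c \<le> value_trunc c 1"
    by (rule opt_value_le) simp
  also have "\<dots> < \<infinity>"
    using bayes_loss_finite by (simp add: value_trunc_def V_trunc_self)
  finally show ?thesis .
qed

lemma opt_value_le_risk_trunc:
  assumes "\<psi> \<in> stopping_rules S" "1 \<le> N"
  shows "opt_value c \<le> risk_trunc S c N \<psi>"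
  using opt_value_le[of N c] stage_risk_V_trunc_mono[OF assms(1), of 1 N N c] assms(2)
  by (simp only: stage_risk_1_V_trunc risk_trunc_eq_stage_risk) auto

text \<open>The bound holds for every truncated risk, and truncatability carries it to the
  limit.\<close>

lemma opt_value_le_risk:
  assumes "truncatable_problem S c" "\<psi> \<in> stopping_rules S"
  shows "opt_value c \<le> risk S c \<psi>"
proof (rule LIMSEQ_le_const)
  show "(\<lambda>N. risk_trunc S c N \<psi>) \<longlonglongrightarrow> risk S c \<psi>"
    using assms by (simp add: truncatable_problem_def truncatable_rule_def)
  show "\<exists>N. \<forall>n\<ge>N. opt_value c \<le> risk_trunc S c n \<psi>"
    using opt_value_le_risk_trunc[OF assms(2)] by blast
qed

text \<open>Backward induction for horizon \<open>N\<close>, with ties resolved by stopping. The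
  clause \<open>N \<le> n\<close> forces stopping at \<open>N\<close> and fixes the values beyond
  it.\<close>

definition trunc_rule :: "real \<Rightarrow> nat \<Rightarrow> nat \<Rightarrow> (nat \<Rightarrow> 'x) \<Rightarrow> real" where
  "trunc_rule c N n x = (if N \<le> n \<or> bayes_loss S n x \<le> Q_trunc S c N n x then 1 else 0)"

lemma trunc_rule_stopping_rule: "trunc_rule c N \<in> stopping_rules S"
proof -
  have "trunc_rule c N n \<in> borel_measurable (mu_n S n)" if "1 \<le> n" for n
  proof (cases "N \<le> n")
    case True
    then show ?thesis by (simp add: trunc_rule_def[abs_def])
  next
    case False
    have [measurable]: "Q_trunc S c N n \<in> borel_measurable (mu_n S n)"
      "bayes_loss S n \<in> borel_measurable (mu_n S n)"
      using False that by (auto intro: Q_trunc_measurable bayes_loss_measurable)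
    show ?thesis using False unfolding trunc_rule_def by simp
  qed
  then show ?thesis by (auto simp: stopping_rules_def trunc_rule_def)
qed

lemma t_psi_trunc_rule:
  assumes "1 \<le> N" "N < n"
  shows "t_psi (trunc_rule c N) n x = 0"
  unfolding t_psi_def using assms
  by (intro prod_zero bexI[of _ N]) (auto simp: trunc_rule_def)

text \<open>Full weight always goes to a cheapest action, so the stagewise inequalities become
  equalities.\<close>

lemma risk_trunc_trunc_rule_self:
  assumes "1 \<le> N"
  shows "risk_trunc S c N (trunc_rule c N) = value_trunc c N"
proof -
  let ?R = "\<lambda>m. stage_risk S c (trunc_rule c N) m (V_trunc S c N m)"
  have "?R 1 = ?R m" if "1 \<le> m" "m \<le> N" for m
    using that
  proof (induction m rule: dec_induct)
    case (step m)
    have "?R m = ?R (Suc m)"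
    proof -
      have "(\<lambda>x. ennreal (trunc_rule c N m x) * bayes_loss S m x
          + ennreal (1 - trunc_rule c N m x) * Q_trunc S c N m x) = V_trunc S c N m"
        using step by (auto simp: trunc_rule_def V_trunc_rec min_def fun_eq_iff)
      then show ?thesis
        using step by (simp add: stage_risk_Suc_V_trunc trunc_rule_stopping_rule)
    qed
    with step show ?case by simp
  qed simp
  then show ?thesis
    using assms by (simp only: risk_trunc_eq_stage_risk stage_risk_1_V_trunc[symmetric, of N c "trunc_rule c N"])
qed

lemma risk_trunc_trunc_rule:
  assumes "1 \<le> N" "N \<le> M"
  shows "risk_trunc S c M (trunc_rule c N) = value_trunc c N"
  using assms(2)
proof (induction M rule: dec_induct)
  case base
  show ?case by (rule risk_trunc_trunc_rule_self[OF assms(1)])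
next
  case (step M)
  \<comment> \<open>From \<open>N\<close> on the rule stops with certainty: the old terminal
    integral turns into the new summand, and the new terminal integral vanishes.\<close>
  have "s_psi (trunc_rule c N) M x = t_psi (trunc_rule c N) M x" for x
    using step by (simp add: s_psi_def trunc_rule_def)
  then have "risk_trunc S c (Suc M) (trunc_rule c N) = risk_trunc S c M (trunc_rule c N)"
    using step assms(1) by (simp add: risk_trunc_def t_psi_trunc_rule)
  with step show ?case by simp
qed

text \<open>The truncated risks are constant from \<open>N\<close> on, and by truncatability their
  limit is the risk.\<close>

lemma risk_trunc_rule:
  assumes "truncatable_problem S c" "1 \<le> N"
  shows "risk S c (trunc_rule c N) = value_trunc c N"
proof (rule LIMSEQ_unique)
  show "(\<lambda>M. risk_trunc S c M (trunc_rule c N)) \<longlonglongrightarrow> risk S c (trunc_rule c N)"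
    using assms trunc_rule_stopping_rule by (simp add: truncatable_problem_def truncatable_rule_def)
  show "(\<lambda>M. risk_trunc S c M (trunc_rule c N)) \<longlonglongrightarrow> value_trunc c N"
    using risk_trunc_trunc_rule[OF assms(2)]
    by (intro tendsto_eventually eventually_sequentiallyI[of N])
qed

lemma INF_risk_eq_opt_value:
  assumes "truncatable_problem S c"
  shows "(INF \<psi>\<in>stopping_rules S. risk S c \<psi>) = opt_value c"
proof (rule antisym)
  show "(INF \<psi>\<in>stopping_rules S. risk S c \<psi>) \<le> opt_value c"
    unfolding opt_value_def
  proof (rule INF_greatest)
    fix N :: nat assume "N \<in> {1..}"
    then show "(INF \<psi>\<in>stopping_rules S. risk S c \<psi>) \<le> value_trunc c N"
      using INF_lower[OF trunc_rule_stopping_rule, of "risk S c" c N] risk_trunc_rule[OF assms, of N]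
      by simp
  qed
  show "opt_value c \<le> (INF \<psi>\<in>stopping_rules S. risk S c \<psi>)"
    by (rule INF_greatest) (rule opt_value_le_risk[OF assms])
qed

subsection \<open>The law of the stopping time\<close>

lemma Rnd_vec_measurable:
  assumes "\<theta> \<in> space (Par S)"
  shows "(\<lambda>\<omega>. \<lambda>i\<in>{1..n}. Rnd S i \<omega>) \<in> measurable (Law S \<theta>) (Pi\<^sub>M {1..n} (\<lambda>_. borel))"
  using Rnd_indep[OF assms] unfolding prob_space.indep_vars_def[OF prob_Law[OF assms]]
  by (intro measurable_restrict) auto

lemma obs_vec_measurable:
  assumes "\<theta> \<in> space (Par S)"
  shows "obs_vec S n \<in> measurable (Law S \<theta>) (mu_n S n)"
  unfolding obs_vec_def[abs_def] mu_n_def using Obs_measurable[OF assms]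
  by (intro measurable_restrict) simp

text \<open>\<open>Rnd_indep_Obs\<close> concerns the whole sequences. Finite vectors are
  restrictions of these, so both sides of a rectangle pull back to independent events, and
  rectangles determine the product measure.\<close>

lemma distr_Rnd_vec_obs_vec:
  fixes n :: nat
  assumes theta: "\<theta> \<in> space (Par S)"
  defines "U \<equiv> \<lambda>\<omega>. \<lambda>i\<in>{1..n}. Rnd S i \<omega>" and "B \<equiv> Pi\<^sub>M {1..n} (\<lambda>_. borel)"
  shows "distr (Law S \<theta>) B U \<Otimes>\<^sub>M distr (Law S \<theta>) (mu_n S n) (obs_vec S n)
    = distr (Law S \<theta>) (B \<Otimes>\<^sub>M mu_n S n) (\<lambda>\<omega>. (U \<omega>, obs_vec S n \<omega>))"
proof (rule pair_measure_eqI)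
  interpret L: prob_space "Law S \<theta>" by (rule prob_Law[OF theta])
  have U [measurable]: "U \<in> measurable (Law S \<theta>) B"
    unfolding U_def B_def by (rule Rnd_vec_measurable[OF theta])
  have X [measurable]: "obs_vec S n \<in> measurable (Law S \<theta>) (mu_n S n)"
    by (rule obs_vec_measurable[OF theta])
  show "sigma_finite_measure (distr (Law S \<theta>) B U)"
    "sigma_finite_measure (distr (Law S \<theta>) (mu_n S n) (obs_vec S n))"
    by (intro prob_space_imp_sigma_finite L.prob_space_distr U X)+
  show "sets (distr (Law S \<theta>) B U \<Otimes>\<^sub>M distr (Law S \<theta>) (mu_n S n) (obs_vec S n))
    = sets (distr (Law S \<theta>) (B \<Otimes>\<^sub>M mu_n S n) (\<lambda>\<omega>. (U \<omega>, obs_vec S n \<omega>)))"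
    by (simp cong: sets_pair_measure_cong)
  fix C D assume "C \<in> sets (distr (Law S \<theta>) B U)" "D \<in> sets (distr (Law S \<theta>) (mu_n S n) (obs_vec S n))"
  then have C [measurable]: "C \<in> sets B" and D [measurable]: "D \<in> sets (mu_n S n)" by auto
  let ?Uinf = "\<lambda>\<omega>. \<lambda>i\<in>{1..}. Rnd S i \<omega>" and ?Xinf = "\<lambda>\<omega>. \<lambda>i\<in>{1..}. Obs S i \<omega>"
  have "(\<lambda>u. restrict u {1..n}) -` C \<inter> space (Pi\<^sub>M {1..} (\<lambda>_. borel)) \<in> sets (Pi\<^sub>M {1..} (\<lambda>_. borel :: real measure))"
    using C unfolding B_def by (intro measurable_sets[OF measurable_restrict_subset]) auto
  from in_vimage_algebra[OF this, of ?Uinf "space (Law S \<theta>)"]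
  have C': "U -` C \<inter> space (Law S \<theta>) \<in> sets (vimage_algebra (space (Law S \<theta>)) ?Uinf (Pi\<^sub>M {1..} (\<lambda>_. borel)))"
    (is "_ \<in> ?SU")
  proof (rule back_subst[where P = "\<lambda>A. A \<in> ?SU"])
    have "restrict (?Uinf \<omega>) {1..n} = U \<omega>" for \<omega> by (auto simp: U_def fun_eq_iff)
    then show "?Uinf -` ((\<lambda>u. restrict u {1..n}) -` C \<inter> space (Pi\<^sub>M {1..} (\<lambda>_. borel))) \<inter> space (Law S \<theta>)
        = U -` C \<inter> space (Law S \<theta>)"
      by (auto simp: space_PiM)
  qed
  have "(\<lambda>x. restrict x {1..n}) -` D \<inter> space (Pi\<^sub>M {1..} (\<lambda>_. mu S)) \<in> sets (Pi\<^sub>M {1..} (\<lambda>_. mu S))"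
    using D unfolding mu_n_def by (intro measurable_sets[OF measurable_restrict_subset]) auto
  from in_vimage_algebra[OF this, of ?Xinf "space (Law S \<theta>)"]
  have D': "obs_vec S n -` D \<inter> space (Law S \<theta>) \<in> sets (vimage_algebra (space (Law S \<theta>)) ?Xinf (Pi\<^sub>M {1..} (\<lambda>_. mu S)))"
    (is "_ \<in> ?SX")
  proof (rule back_subst[where P = "\<lambda>A. A \<in> ?SX"])
    have "restrict (?Xinf \<omega>) {1..n} = obs_vec S n \<omega>" for \<omega> by (auto simp: obs_vec_def fun_eq_iff)
    then show "?Xinf -` ((\<lambda>x. restrict x {1..n}) -` D \<inter> space (Pi\<^sub>M {1..} (\<lambda>_. mu S))) \<inter> space (Law S \<theta>)
        = obs_vec S n -` D \<inter> space (Law S \<theta>)"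
      \<comment> \<open>Unlike the real-valued \<open>Rnd\<close>, the observations must first be
        placed in the space of \<open>mu S\<close>.\<close>
      using measurable_space[OF Obs_measurable[OF theta]] by (auto simp: space_PiM)
  qed
  have "(\<lambda>\<omega>. (U \<omega>, obs_vec S n \<omega>)) -` (C \<times> D) \<inter> space (Law S \<theta>)
      = (U -` C \<inter> space (Law S \<theta>)) \<inter> (obs_vec S n -` D \<inter> space (Law S \<theta>))"
    by auto
  moreover have "L.prob ((U -` C \<inter> space (Law S \<theta>)) \<inter> (obs_vec S n -` D \<inter> space (Law S \<theta>)))
      = L.prob (U -` C \<inter> space (Law S \<theta>)) * L.prob (obs_vec S n -` D \<inter> space (Law S \<theta>))"
    by (rule L.indep_setD[OF Rnd_indep_Obs[OF theta] C' D'])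
  ultimately show "emeasure (distr (Law S \<theta>) B U) C * emeasure (distr (Law S \<theta>) (mu_n S n) (obs_vec S n)) D
      = emeasure (distr (Law S \<theta>) (B \<Otimes>\<^sub>M mu_n S n) (\<lambda>\<omega>. (U \<omega>, obs_vec S n \<omega>))) (C \<times> D)"
    by (simp add: emeasure_distr L.emeasure_eq_measure ennreal_mult)
qed

lemma distr_Rnd_vec:
  assumes theta: "\<theta> \<in> space (Par S)" and "n \<ge> 1"
  shows "distr (Law S \<theta>) (Pi\<^sub>M {1..n} (\<lambda>_. borel)) (\<lambda>\<omega>. \<lambda>i\<in>{1..n}. Rnd S i \<omega>)
    = Pi\<^sub>M {1..n} (\<lambda>_. uniform_measure lborel {0..1})"
proof -
  interpret prob_space "Law S \<theta>" by (rule prob_Law[OF theta])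
  have indep: "indep_vars (\<lambda>_. borel) (Rnd S) {1..n}"
    by (rule indep_vars_subset[OF Rnd_indep[OF theta]]) auto
  then have "distr (Law S \<theta>) (Pi\<^sub>M {1..n} (\<lambda>_. borel)) (\<lambda>\<omega>. \<lambda>i\<in>{1..n}. Rnd S i \<omega>)
      = Pi\<^sub>M {1..n} (\<lambda>i. distr (Law S \<theta>) borel (Rnd S i))"
    using \<open>n \<ge> 1\<close>
    by (intro indep_vars_iff_distr_eq_PiM'[THEN iffD1]) (auto simp: indep_vars_def)
  also have "\<dots> = Pi\<^sub>M {1..n} (\<lambda>_. uniform_measure lborel {0..1})"
    by (intro PiM_cong refl Rnd_uniform[OF theta]) auto
  finally show ?thesis .
qed

text \<open>Given the observations, the events \<open>U_k > \<psi>_k\<close> are independent with probabilities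
  \<open>1 - \<psi>_k\<close>, so integrating out the randomizing variables first leaves \<open>s_n\<close>.\<close>

lemma emeasure_stop_time_eq:
  assumes theta: "\<theta> \<in> space (Par S)" and psi: "\<psi> \<in> stopping_rules S" and n: "n \<ge> 1"
  shows "emeasure (Law S \<theta>) {\<omega> \<in> space (Law S \<theta>). stop_time S \<psi> \<omega> = enat n}
    = (\<integral>\<^sup>+ \<omega>. ennreal (s_psi \<psi> n (obs_vec S n \<omega>)) \<partial>Law S \<theta>)"
proof -
  interpret L: prob_space "Law S \<theta>" by (rule prob_Law[OF theta])
  let ?unif = "uniform_measure lborel {0..1::real}"
  let ?U = "\<lambda>\<omega>. \<lambda>i\<in>{1..n}. Rnd S i \<omega>" and ?X = "obs_vec S n"
  let ?PU = "Pi\<^sub>M {1..n} (\<lambda>_. ?unif)" and ?PX = "distr (Law S \<theta>) (mu_n S n) ?X"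
  let ?B = "Pi\<^sub>M {1..n} (\<lambda>_. borel :: real measure)"
  have unif: "prob_space ?unif"
    by (rule prob_space_uniform_measure) auto
  interpret PU: product_prob_space "\<lambda>_. ?unif" "{1..n}"
    using unif by (simp add: product_prob_space_def product_prob_space_axioms_def
        product_sigma_finite_def prob_space_imp_sigma_finite)
  have sets_PU: "sets ?PU = sets ?B"
    by (intro sets_PiM_cong) auto
  have U [measurable]: "?U \<in> measurable (Law S \<theta>) ?B" and X [measurable]: "?X \<in> measurable (Law S \<theta>) (mu_n S n)"
    and joint: "distr (Law S \<theta>) ?B ?U \<Otimes>\<^sub>M ?PX = distr (Law S \<theta>) (?B \<Otimes>\<^sub>M mu_n S n) (\<lambda>\<omega>. (?U \<omega>, ?X \<omega>))"
    by (rule Rnd_vec_measurable[OF theta] obs_vec_measurable[OF theta] distr_Rnd_vec_obs_vec[OF theta])+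
  have PX: "prob_space ?PX"
    by (rule L.prob_space_distr[OF X])
  interpret pair_sigma_finite ?PU ?PX
    using PX product_sigma_finite.sigma_finite[OF PU.product_sigma_finite_axioms finite_atLeastAtMost]
    by (simp only: pair_sigma_finite_def prob_space_imp_sigma_finite)
  \<comment> \<open>The event that \<open>\<psi>\<close> stops at \<open>n\<close>, in terms of the
    joint vector. Its sections at fixed \<open>x\<close> are boxes, which a product measure
    evaluates factor by factor.\<close>
  define A where "A = {z \<in> space (?B \<Otimes>\<^sub>M mu_n S n).
    (\<forall>k\<in>{1..<n}. \<psi> k (restrict (snd z) {1..k}) < fst z k) \<and> fst z n \<le> \<psi> n (snd z)}"
  have A: "A \<in> sets (?B \<Otimes>\<^sub>M mu_n S n)"
    unfolding A_def
  proof (intro sets.sets_Collect_conj sets.sets_Collect_finite_All)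
    fix k assume k: "k \<in> {1..<n}"
    have [measurable]: "(\<lambda>u. u k) \<in> borel_measurable ?B"
      using k by (intro measurable_component_singleton) simp
    have [measurable]: "(\<lambda>x. \<psi> k (restrict x {1..k})) \<in> borel_measurable (mu_n S n)"
      using k by (intro measurable_compose[OF restrict_measurable_mu_n stopping_rule_measurable[OF psi]]) auto
    show "{z \<in> space (?B \<Otimes>\<^sub>M mu_n S n). \<psi> k (restrict (snd z) {1..k}) < fst z k} \<in> sets (?B \<Otimes>\<^sub>M mu_n S n)"
      by measurable
  next
    have [measurable]: "(\<lambda>u. u n) \<in> borel_measurable ?B"
      using n by (intro measurable_component_singleton) simp
    have [measurable]: "\<psi> n \<in> borel_measurable (mu_n S n)"
      by (rule stopping_rule_measurable[OF psi n])
    show "{z \<in> space (?B \<Otimes>\<^sub>M mu_n S n). fst z n \<le> \<psi> n (snd z)} \<in> sets (?B \<Otimes>\<^sub>M mu_n S n)"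
      by measurable
  qed simp
  have obs_restrict: "restrict (obs_vec S n \<omega>) {1..k} = obs_vec S k \<omega>" if "k < n" for k \<omega>
    using that by (auto simp: obs_vec_def fun_eq_iff)
  have "{\<omega> \<in> space (Law S \<theta>). stop_time S \<psi> \<omega> = enat n} = (\<lambda>\<omega>. (?U \<omega>, ?X \<omega>)) -` A \<inter> space (Law S \<theta>)"
    using measurable_space[OF U] measurable_space[OF X] n
    by (auto simp: A_def stop_time_eq_iff space_pair_measure obs_restrict simp del: One_nat_def)
  then have "emeasure (Law S \<theta>) {\<omega> \<in> space (Law S \<theta>). stop_time S \<psi> \<omega> = enat n}
      = emeasure (distr (Law S \<theta>) (?B \<Otimes>\<^sub>M mu_n S n) (\<lambda>\<omega>. (?U \<omega>, ?X \<omega>))) A"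
    by (simp only: emeasure_distr[OF measurable_Pair[OF U X] A])
  also have "\<dots> = emeasure (?PU \<Otimes>\<^sub>M ?PX) A"
    unfolding joint[symmetric] distr_Rnd_vec[OF theta n] ..
  also have "\<dots> = (\<integral>\<^sup>+ x. emeasure ?PU ((\<lambda>u. (u, x)) -` A) \<partial>?PX)"
    using A by (intro emeasure_pair_measure_alt2) (simp add: sets_PU cong: sets_pair_measure_cong)
  also have "\<dots> = (\<integral>\<^sup>+ x. ennreal (s_psi \<psi> n x) \<partial>?PX)"
  proof (rule nn_integral_cong)
    fix x assume "x \<in> space ?PX"
    then have x: "x \<in> space (mu_n S n)" by simp
    let ?p = "\<lambda>k. \<psi> k (restrict x {1..k})"
    let ?E = "\<lambda>k. if k < n then {?p k<..} else {..?p k}"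
    have p: "0 \<le> ?p k" "?p k \<le> 1" if "k \<in> {1..n}" for k
      using that x stopping_rule_bounds[OF psi, of k "restrict x {1..k}"]
        measurable_space[OF restrict_measurable_mu_n[of k n] x] by auto
    have "(\<lambda>u. (u, x)) -` A = Pi\<^sub>E {1..n} ?E"
    proof (intro set_eqI iffI)
      fix u assume "u \<in> (\<lambda>u. (u, x)) -` A"
      then show "u \<in> Pi\<^sub>E {1..n} ?E"
        using restrict_space_mu_n[OF x]
        by (auto simp: A_def space_pair_measure space_PiM PiE_iff simp del: One_nat_def)
    next
      fix u assume u: "u \<in> Pi\<^sub>E {1..n} ?E"
      then have "u k \<in> ?E k" if "k \<in> {1..n}" for k
        using that by (rule PiE_mem)
      moreover have "u \<in> space ?B"
        using u by (auto simp: space_PiM PiE_iff)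
      ultimately show "u \<in> (\<lambda>u. (u, x)) -` A"
        using x n restrict_space_mu_n[OF x] by (force simp: A_def space_pair_measure)
    qed
    then have "emeasure ?PU ((\<lambda>u. (u, x)) -` A) = (\<Prod>k\<in>{1..n}. emeasure ?unif (?E k))"
      by (simp only:) (rule PU.emeasure_PiM, auto)
    also have "\<dots> = (\<Prod>k\<in>{1..n}. ennreal (if k < n then 1 - ?p k else ?p k))"
      by (intro prod.cong refl) (simp only: emeasure_uniform_unit[OF p] if_distrib[of "emeasure ?unif"] if_distrib[of ennreal])
    also have "\<dots> = ennreal (\<Prod>k\<in>{1..n}. if k < n then 1 - ?p k else ?p k)"
      using p by (intro prod_ennreal) simp
    also have "(\<Prod>k\<in>{1..n}. if k < n then 1 - ?p k else ?p k)
        = (\<Prod>k\<in>insert n {1..<n}. if k < n then 1 - ?p k else ?p k)"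
      using n by (intro prod.cong) auto
    also have "\<dots> = s_psi \<psi> n x"
      using restrict_space_mu_n[OF x] by (subst prod.insert) (auto simp: s_psi_def t_psi_def mult.commute)
    finally show "emeasure ?PU ((\<lambda>u. (u, x)) -` A) = ennreal (s_psi \<psi> n x)" .
  qed
  also have "\<dots> = (\<integral>\<^sup>+ \<omega>. ennreal (s_psi \<psi> n (obs_vec S n \<omega>)) \<partial>Law S \<theta>)"
    using s_psi_measurable[OF psi n] by (subst nn_integral_distr) auto
  finally show ?thesis .
qed

text \<open>This eliminates the randomizing variables: stopping probabilities become integrals of
  the same kind as those in the risk.\<close>

lemma stop_prob_eq:
  assumes psi: "\<psi> \<in> stopping_rules S" and n: "n \<ge> 1"
  shows "stop_prob S \<psi> n = (\<integral>\<^sup>+ x. ennreal (s_psi \<psi> n x) * mix_dens S n x \<partial>mu_n S n)"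
proof -
  have "stop_prob S \<psi> n = (\<integral>\<^sup>+ \<theta>. \<integral>\<^sup>+ \<omega>. ennreal (s_psi \<psi> n (obs_vec S n \<omega>)) \<partial>Law S \<theta> \<partial>prior2 S)"
    unfolding stop_prob_def
    by (intro nn_integral_cong emeasure_stop_time_eq psi n) (simp add: space_prior)
  also have "\<dots> = (\<integral>\<^sup>+ x. mix_dens S n x * ennreal (s_psi \<psi> n x) \<partial>mu_n S n)"
    using s_psi_measurable[OF psi n] n by (intro nn_integral_mix_dens[symmetric]) auto
  finally show ?thesis by (simp add: mult.commute)
qed

text \<open>Mass reaching time \<open>r\<close> either stops there or goes on, that is,
  \<open>s_r + t_(r+1) = t_r\<close>; the initial mass is \<open>1\<close>.\<close>

lemma stop_prob_telescope:
  assumes psi: "\<psi> \<in> stopping_rules S" and "r \<ge> 1"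
  shows "(\<Sum>n\<in>{1..<r}. stop_prob S \<psi> n) + (\<integral>\<^sup>+ x. ennreal (t_psi \<psi> r x) * mix_dens S r x \<partial>mu_n S r) = 1"
  using assms(2)
proof (induction r rule: dec_induct)
  case base
  show ?case using nn_integral_mix_dens_1[of 1] by simp
next
  case (step r)
  let ?t = "\<lambda>x. ennreal (t_psi \<psi> r x)" and ?f = "mix_dens S r"
  have [measurable]: "t_psi \<psi> r \<in> borel_measurable (mu_n S r)" "\<psi> r \<in> borel_measurable (mu_n S r)"
    "s_psi \<psi> r \<in> borel_measurable (mu_n S r)"
    using step psi by (auto intro: t_psi_measurable stopping_rule_measurable s_psi_measurable)
  have "stop_prob S \<psi> r + (\<integral>\<^sup>+ x. ennreal (t_psi \<psi> (Suc r) x) * mix_dens S (Suc r) x \<partial>mu_n S (Suc r))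
      = (\<integral>\<^sup>+ x. ennreal (s_psi \<psi> r x) * ?f x + ?t x * ennreal (1 - \<psi> r x) * ?f x \<partial>mu_n S r)"
    unfolding stop_prob_eq[OF psi step(1)] nn_integral_t_psi_Suc_mix_dens[OF psi step(1)]
    by (rule nn_integral_add[symmetric]) measurable
  also have "\<dots> = (\<integral>\<^sup>+ x. ?t x * ?f x \<partial>mu_n S r)"
  proof (rule nn_integral_cong)
    fix x assume x: "x \<in> space (mu_n S r)"
    then have "ennreal (\<psi> r x) + ennreal (1 - \<psi> r x) = 1"
      using stopping_rule_bounds[OF psi step(1), of x] by (simp flip: ennreal_plus)
    then show "ennreal (s_psi \<psi> r x) * ?f x + ?t x * ennreal (1 - \<psi> r x) * ?f x = ?t x * ?f x"
      unfolding ennreal_s_psi[OF psi step(1) x] by (metis distrib_left distrib_right mult.right_neutral)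
  qed
  finally have *: "stop_prob S \<psi> r + (\<integral>\<^sup>+ x. ennreal (t_psi \<psi> (Suc r) x) * mix_dens S (Suc r) x \<partial>mu_n S (Suc r))
      = (\<integral>\<^sup>+ x. ?t x * ?f x \<partial>mu_n S r)" .
  show ?case
    using step(3) step(1) unfolding *[symmetric] sum.atLeastLessThan_Suc[OF step(1)] by (simp only: add.assoc)
qed

subsection \<open>Optimal rules and the threshold conditions\<close>

text \<open>A surplus paid at one stage is never recovered: the values up to stage \<open>r\<close>
  are at least \<open>opt_value\<close>, and those after it only grow.\<close>

lemma opt_value_add_gain_le_risk_trunc:
  assumes psi: "\<psi> \<in> stopping_rules S" and r: "1 \<le> r" "r < N"
    and [measurable]: "g \<in> borel_measurable (mu_n S r)"
    and gain: "\<And>x. x \<in> space (mu_n S r) \<Longrightarrow> V_trunc S c N r x + g x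
      \<le> ennreal (\<psi> r x) * bayes_loss S r x + ennreal (1 - \<psi> r x) * Q_trunc S c N r x"
  shows "opt_value c + (\<integral>\<^sup>+ x. ennreal (t_psi \<psi> r x) * g x \<partial>mu_n S r) \<le> risk_trunc S c N \<psi>"
proof -
  have [measurable]: "t_psi \<psi> r \<in> borel_measurable (mu_n S r)" "V_trunc S c N r \<in> borel_measurable (mu_n S r)"
    using psi r by (auto intro: t_psi_measurable V_trunc_measurable)
  have "stage_risk S c \<psi> r (V_trunc S c N r) + (\<integral>\<^sup>+ x. ennreal (t_psi \<psi> r x) * g x \<partial>mu_n S r)
      = stage_risk S c \<psi> r (\<lambda>x. V_trunc S c N r x + g x)"
  proof -
    have "(\<integral>\<^sup>+ x. ennreal (t_psi \<psi> r x) * (ennreal c * of_nat r * mix_dens S r x + V_trunc S c N r x) \<partial>mu_n S r)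
        + (\<integral>\<^sup>+ x. ennreal (t_psi \<psi> r x) * g x \<partial>mu_n S r)
      = (\<integral>\<^sup>+ x. ennreal (t_psi \<psi> r x) * (ennreal c * of_nat r * mix_dens S r x + (V_trunc S c N r x + g x)) \<partial>mu_n S r)"
      by (subst nn_integral_add[symmetric]) (auto simp: distrib_left add.assoc)
    then show ?thesis
      unfolding stage_risk_def by (simp only: add.assoc)
  qed
  also have "\<dots> \<le> stage_risk S c \<psi> (Suc r) (V_trunc S c N (Suc r))"
    unfolding stage_risk_Suc_V_trunc[OF psi r] using gain by (intro stage_risk_mono AE_I2) auto
  also have "\<dots> \<le> risk_trunc S c N \<psi>"
    unfolding risk_trunc_eq_stage_risk using r by (intro stage_risk_V_trunc_mono psi) auto
  finally have "stage_risk S c \<psi> r (V_trunc S c N r) + (\<integral>\<^sup>+ x. ennreal (t_psi \<psi> r x) * g x \<partial>mu_n S r)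
      \<le> risk_trunc S c N \<psi>" .
  moreover have "opt_value c \<le> stage_risk S c \<psi> r (V_trunc S c N r)"
    using opt_value_le[of N c] stage_risk_V_trunc_mono[OF psi, of 1 r N c] r
      stage_risk_1_V_trunc[of N c \<psi>] by simp
  ultimately show ?thesis
    by (meson add_right_mono order_trans)
qed

text \<open>For all \<open>N \<ge> M\<close>, \<open>qN\<close> lies between \<open>q\<close> and
  \<open>qM\<close>. So continuing when \<open>l < q\<close> loses at least \<open>q - l\<close>,
  and stopping when \<open>qM < l\<close> loses at least \<open>l - qM\<close>. These losses are
  free of \<open>N\<close> and survive its passage to infinity.\<close>

lemma stop_gain:
  fixes x :: "nat \<Rightarrow> 'x" and p c :: real
  assumes "0 \<le> p" "p \<le> 1" "r < M" "M \<le> N"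
  defines "l \<equiv> bayes_loss S r x" and "q \<equiv> Q_lim S c r x" and "qM \<equiv> Q_trunc S c M r x"
    and "qN \<equiv> Q_trunc S c N r x"
  shows "V_trunc S c N r x + (if l < q then ennreal (1 - p) * (q - l)
      else if qM < l then ennreal p * (l - qM) else 0)
    \<le> ennreal p * l + ennreal (1 - p) * qN"
proof -
  have le: "q \<le> qN" "qN \<le> qM"
    using assms by (auto intro: Q_lim_le_Q_trunc Q_trunc_antimono_le)
  have V: "V_trunc S c N r x = min l qN"
    using assms by (simp add: V_trunc_rec)
  consider "l < q" | "\<not> l < q" "qM < l" | "\<not> l < q" "\<not> qM < l" by blast
  then show ?thesis
  proof cases
    case 1
    then have "l + (q - l) \<le> qN"
      using le by (simp add: add_diff_inverse_ennreal less_imp_le)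
    from convex_le_add_gain[OF this, of "1 - p"] show ?thesis
      using 1 assms(1,2) le by (simp add: V min.absorb1 add.commute)
  next
    case 2
    have "qN + (l - qM) \<le> qM + (l - qM)"
      using le by (intro add_right_mono) auto
    also have "\<dots> = l"
      using 2 by (simp add: add_diff_inverse_ennreal less_imp_le)
    finally show ?thesis
      using convex_le_add_gain[of qN "l - qM" l p] 2 assms(1,2) le by (simp add: V min.absorb2)
  next
    case 3
    then show ?thesis
      using min_le_convex[OF assms(1,2), of l qN] by (simp add: V)
  qed
qed

text \<open>The gain is measured against a fixed horizon \<open>M\<close>, not against \<open>Q_lim\<close>: the \<open>l_n\<close>
  with \<open>n \<ge> 2\<close> need not be integrable, so there is no passing to the limit under the integral.\<close>

lemma optimal_imp_threshold:
  assumes psi: "\<psi> \<in> stopping_rules S" and trunc: "truncatable_problem S c"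
    and opt: "risk S c \<psi> = opt_value c" and r: "1 \<le> r"
  shows "AE x in mu_n S r. x \<in> T_psi S \<psi> r \<longrightarrow>
    indicator {x. bayes_loss S r x < Q_lim S c r x} x \<le> \<psi> r x \<and>
    \<psi> r x \<le> indicator {x. bayes_loss S r x \<le> Q_lim S c r x} x"
proof -
  let ?l = "bayes_loss S r" and ?q = "Q_lim S c r"
  define g where "g M x = (if ?l x < ?q x then ennreal (1 - \<psi> r x) * (?q x - ?l x)
      else if Q_trunc S c M r x < ?l x then ennreal (\<psi> r x) * (?l x - Q_trunc S c M r x) else 0)" for M x
  have [measurable]: "t_psi \<psi> r \<in> borel_measurable (mu_n S r)" "\<psi> r \<in> borel_measurable (mu_n S r)"
    "?l \<in> borel_measurable (mu_n S r)"
    using psi r by (auto intro: t_psi_measurable stopping_rule_measurable bayes_loss_measurable)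
  have g [measurable]: "g M \<in> borel_measurable (mu_n S r)" if "r < M" for M
    using Q_trunc_measurable[OF that, of c] unfolding g_def by measurable
  have "AE x in mu_n S r. ennreal (t_psi \<psi> r x) * g M x = 0" if M: "r < M" for M
  proof -
    let ?G = "\<integral>\<^sup>+ x. ennreal (t_psi \<psi> r x) * g M x \<partial>mu_n S r"
    have "opt_value c + ?G \<le> opt_value c"
    proof (rule LIMSEQ_le_const)
      show "(\<lambda>N. risk_trunc S c N \<psi>) \<longlonglongrightarrow> opt_value c"
        using trunc psi opt by (metis truncatable_problem_def truncatable_rule_def)
      have "opt_value c + ?G \<le> risk_trunc S c N \<psi>" if "M \<le> N" for N
        unfolding g_def using that M r
        by (intro opt_value_add_gain_le_risk_trunc psi g[OF M, unfolded g_def] stop_gain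
            stopping_rule_bounds) auto
      then show "\<exists>N. \<forall>n\<ge>N. opt_value c + ?G \<le> risk_trunc S c n \<psi>" by blast
    qed
    \<comment> \<open>Cancellation in \<open>ennreal\<close> relies on \<open>opt_value c\<close>
      being finite.\<close>
    then have "?G = 0"
      using ennreal_add_left_cancel_le[of "opt_value c" ?G 0] opt_value_finite[of c] by auto
    then show ?thesis
      using g[OF M] by (subst (asm) nn_integral_0_iff_AE) auto
  qed
  \<comment> \<open>There are countably many horizons, so one null set serves them all.\<close>
  then have "AE x in mu_n S r. \<forall>M\<in>{r<..}. ennreal (t_psi \<psi> r x) * g M x = 0"
    by (subst AE_ball_countable) auto
  moreover have "AE x in mu_n S r. x \<in> space (mu_n S r)"
    by (rule AE_space)
  ultimately show ?thesis
  proof eventually_elim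
    case (elim x)
    note bounds = stopping_rule_bounds[OF psi r elim(2)]
    show ?case
    proof
      assume "x \<in> T_psi S \<psi> r"
      then have g0: "g M x = 0" if "r < M" for M
        using elim(1) that by (auto simp: T_psi_def)
      have "\<psi> r x = 1" if "?l x < ?q x"
      proof -
        have "0 < ?q x - ?l x"
          using that by (simp add: diff_gr0_ennreal)
        \<comment> \<open>This branch of \<open>g\<close> does not involve the horizon;
          \<open>Suc r\<close> stands for any.\<close>
        then show ?thesis
          using g0[of "Suc r"] that bounds by (auto simp: g_def ennreal_eq_0_iff)
      qed
      moreover have "\<psi> r x = 0" if "?q x < ?l x"
      proof -
        \<comment> \<open>Strict inequality with an infimum is already witnessed at some finite
          horizon.\<close>
        obtain M where "r < M" "Q_trunc S c M r x < ?l x"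
          using \<open>?q x < ?l x\<close> unfolding Q_lim_eq_INF INF_less_iff by auto
        moreover from this(2) have "0 < ?l x - Q_trunc S c M r x"
          by (simp add: diff_gr0_ennreal)
        moreover have "\<not> ?l x < ?q x"
          using that by simp
        ultimately show ?thesis
          using g0[of M] bounds by (auto simp: g_def ennreal_eq_0_iff)
      qed
      ultimately show "indicator {x. ?l x < ?q x} x \<le> \<psi> r x \<and> \<psi> r x \<le> indicator {x. ?l x \<le> ?q x} x"
        using bounds by (auto simp: indicator_def not_le)
    qed
  qed
qed

text \<open>\<open>min l_n Q_n\<close> lies below every \<open>V_trunc\<close>, so continuing with
  it costs at most every \<open>Q_trunc\<close>, hence at most \<open>Q_lim\<close>. This inequality
  replaces an interchange of limit and integral.\<close>

lemma stage_risk_limit_le_opt_value: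
  assumes psi: "\<psi> \<in> stopping_rules S" and r: "1 \<le> r"
    and threshold: "\<And>n. n \<ge> 1 \<Longrightarrow> AE x in mu_n S n. x \<in> T_psi S \<psi> n \<longrightarrow>
      indicator {x. bayes_loss S n x < Q_lim S c n x} x \<le> \<psi> n x \<and>
      \<psi> n x \<le> indicator {x. bayes_loss S n x \<le> Q_lim S c n x} x"
  shows "stage_risk S c \<psi> r (\<lambda>x. min (bayes_loss S r x) (Q_lim S c r x)) \<le> opt_value c"
proof -
  let ?U = "\<lambda>r x. min (bayes_loss S r x) (Q_lim S c r x)"
  have U [measurable]: "?U r \<in> borel_measurable (mu_n S r)" if "1 \<le> r" for r
    using bayes_loss_measurable[OF that] by measurable
  have U_le: "?U n x \<le> V_trunc S c N n x" if "n \<le> N" for n N x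
    using that Q_lim_le_Q_trunc[of n N S c x]
    by (cases "n = N") (auto simp: V_trunc_self V_trunc_rec intro: min.coboundedI2)
  have cont: "ennreal c * mix_dens S n x + (\<integral>\<^sup>+ y. ?U (Suc n) (x(Suc n := y)) \<partial>mu S) \<le> Q_lim S c n x" for n x
    unfolding Q_lim_eq_INF[of S c n x] Q_trunc_def
    by (intro INF_greatest add_left_mono nn_integral_mono U_le) simp
  have "stage_risk S c \<psi> r (?U r) \<le> stage_risk S c \<psi> 1 (?U 1)"
    using r
  proof (induction r rule: dec_induct)
    case (step r)
    have "stage_risk S c \<psi> (Suc r) (?U (Suc r)) \<le> stage_risk S c \<psi> r (?U r)"
      unfolding stage_risk_Suc[OF psi step(1) U[OF le_SucI[OF step(1)]]]
    proof (rule stage_risk_mono)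
      show "AE x in mu_n S r. 0 < t_psi \<psi> r x \<longrightarrow> ennreal (\<psi> r x) * bayes_loss S r x
          + ennreal (1 - \<psi> r x) * (ennreal c * mix_dens S r x
            + (\<integral>\<^sup>+ y. ?U (Suc r) (x(Suc r := y)) \<partial>mu S)) \<le> ?U r x"
        using threshold[OF step(1)] AE_space
      proof eventually_elim
        case (elim x)
        let ?l = "bayes_loss S r x" and ?q = "Q_lim S c r x"
        show ?case
        proof
          assume "0 < t_psi \<psi> r x"
          then have ind: "indicator {x. bayes_loss S r x < Q_lim S c r x} x \<le> \<psi> r x"
            "\<psi> r x \<le> indicator {x. bayes_loss S r x \<le> Q_lim S c r x} x"
            using elim by (auto simp: T_psi_def)
          note bounds = stopping_rule_bounds[OF psi step(1) elim(2)]
          have "ennreal (\<psi> r x) * ?l + ennreal (1 - \<psi> r x) * (ennreal c * mix_dens S r x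
              + (\<integral>\<^sup>+ y. ?U (Suc r) (x(Suc r := y)) \<partial>mu S))
            \<le> ennreal (\<psi> r x) * ?l + ennreal (1 - \<psi> r x) * ?q"
            by (intro add_left_mono mult_left_mono cont) simp
          \<comment> \<open>The threshold conditions put all weight on the cheaper action; at a tie
            any weight gives the common value.\<close>
          also have "\<dots> = min ?l ?q"
          proof (cases ?l ?q rule: linorder_cases)
            case less
            then have "\<psi> r x = 1" using ind(1) bounds by simp
            then show ?thesis using less by (simp add: min.absorb1)
          next
            case equal
            have "ennreal (\<psi> r x) * ?q + ennreal (1 - \<psi> r x) * ?q = ennreal (\<psi> r x + (1 - \<psi> r x)) * ?q"
              using bounds by (subst ennreal_plus) (auto simp: distrib_right)
            then show ?thesis using equal by simp
          next
            case greater
            then have "\<psi> r x = 0" using ind(2) bounds by simp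
            then show ?thesis using greater by (simp add: min.absorb2)
          qed
          finally show "ennreal (\<psi> r x) * ?l + ennreal (1 - \<psi> r x) * (ennreal c * mix_dens S r x
              + (\<integral>\<^sup>+ y. ?U (Suc r) (x(Suc r := y)) \<partial>mu S)) \<le> min ?l ?q" .
        qed
      qed
    qed
    with step show ?case by auto
  qed simp
  also have "\<dots> \<le> opt_value c"
    unfolding opt_value_def
  proof (rule INF_greatest)
    fix N :: nat assume "N \<in> {1..}"
    then show "stage_risk S c \<psi> 1 (?U 1) \<le> value_trunc c N"
      unfolding stage_risk_1[OF U[OF order_refl]] value_trunc_def
      by (intro add_left_mono nn_integral_mono U_le) simp
  qed
  finally show ?thesis .
qed

text \<open>A Markov-type bound: the unstopped mass at time \<open>r\<close> is at most
  \<open>b / (c * r)\<close>, which vanishes, and telescoping turns this into total mass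
  \<open>1\<close>.\<close>

lemma stop_prob_finite_eq_1:
  assumes psi: "\<psi> \<in> stopping_rules S" and "c > 0" "b < \<infinity>"
    and cost: "\<And>r. 1 \<le> r \<Longrightarrow>
      ennreal c * of_nat r * (\<integral>\<^sup>+ x. ennreal (t_psi \<psi> r x) * mix_dens S r x \<partial>mu_n S r) \<le> b"
  shows "stop_prob_finite S \<psi> = 1"
proof -
  \<comment> \<open>The index is shifted: \<open>tail r\<close> is the mass left after the first
    \<open>r\<close> terms of the series.\<close>
  define tail where "tail r = (\<integral>\<^sup>+ x. ennreal (t_psi \<psi> (Suc r) x) * mix_dens S (Suc r) x \<partial>mu_n S (Suc r))" for r
  have sum: "(\<Sum>n<r. stop_prob S \<psi> (Suc n)) + tail r = 1" for r
    using stop_prob_telescope[OF psi, of "Suc r"]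
    by (simp only: tail_def lessThan_atLeast0 One_nat_def sum.atLeast_Suc_lessThan_Suc_shift o_def)
  obtain b' where b': "b = ennreal b'" "0 \<le> b'"
    using \<open>b < \<infinity>\<close> by (cases b) auto
  have tail_le: "tail r \<le> ennreal (b' / c * inverse (real (Suc r)))" for r
  proof -
    \<comment> \<open>Only finiteness is wanted here, so that the division can be done in the
      reals.\<close>
    have "tail r \<le> 1"
      unfolding sum[of r, symmetric] by (rule add_increasing[OF zero_le order_refl])
    then obtain s where s: "tail r = ennreal s" "0 \<le> s"
      by (cases "tail r") (auto simp: top_unique)
    have "ennreal (c * real (Suc r) * s) = ennreal c * of_nat (Suc r) * tail r"
      using s \<open>c > 0\<close> by (simp add: ennreal_mult ennreal_of_nat_eq_real_of_nat del: of_nat_Suc)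
    also have "\<dots> \<le> ennreal b'"
      using cost[of "Suc r"] b' by (simp add: tail_def)
    finally have "c * real (Suc r) * s \<le> b'"
      using b' by (simp add: ennreal_le_iff)
    then have "s \<le> b' / (c * real (Suc r))"
      using \<open>c > 0\<close> by (simp add: pos_le_divide_eq mult.commute del: of_nat_Suc)
    then have "s \<le> b' / c * inverse (real (Suc r))"
      by (simp add: divide_inverse mult.assoc del: of_nat_Suc)
    then show ?thesis
      using s by (simp add: ennreal_leI)
  qed
  have "(\<lambda>r. ennreal (b' / c * inverse (real (Suc r)))) \<longlonglongrightarrow> ennreal (b' / c * 0)"
    by (intro tendsto_ennrealI tendsto_mult tendsto_const LIMSEQ_inverse_real_of_nat)
  then have bound: "(\<lambda>r. ennreal (b' / c * inverse (real (Suc r)))) \<longlonglongrightarrow> 0"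
    by simp
  have tail: "tail \<longlonglongrightarrow> 0"
    by (rule tendsto_sandwich[OF always_eventually always_eventually tendsto_const bound])
      (simp_all only: tail_le zero_le simp_thms)
  have "(\<lambda>r. (\<Sum>n<r. stop_prob S \<psi> (Suc n)) + tail r) \<longlonglongrightarrow> stop_prob_finite S \<psi> + 0"
    unfolding stop_prob_finite_def by (intro tendsto_add summable_LIMSEQ tail) simp
  then show ?thesis
    unfolding sum by (simp add: LIMSEQ_const_iff)
qed

text \<open>Each of the two terms of \<open>stage_risk\<close> is at most \<open>opt_value\<close>.
  The terminal one bounds the tails, so \<open>\<psi>\<close> stops almost surely and the risk is
  the series; the other one bounds its partial sums.\<close>

lemma threshold_imp_risk_le:
  assumes psi: "\<psi> \<in> stopping_rules S" and "c > 0"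
    and threshold: "\<And>n. n \<ge> 1 \<Longrightarrow> AE x in mu_n S n. x \<in> T_psi S \<psi> n \<longrightarrow>
      indicator {x. bayes_loss S n x < Q_lim S c n x} x \<le> \<psi> n x \<and>
      \<psi> n x \<le> indicator {x. bayes_loss S n x \<le> Q_lim S c n x} x"
  shows "risk S c \<psi> \<le> opt_value c"
proof -
  let ?J = "\<lambda>n. \<integral>\<^sup>+ x. ennreal (s_psi \<psi> n x) * total_cost S c n x \<partial>mu_n S n"
  note stage = stage_risk_limit_le_opt_value[OF psi _ threshold, unfolded stage_risk_def]
  have "stop_prob_finite S \<psi> = 1"
  proof (rule stop_prob_finite_eq_1[OF psi \<open>c > 0\<close> opt_value_finite])
    fix r :: nat assume r: "1 \<le> r"
    have [measurable]: "t_psi \<psi> r \<in> borel_measurable (mu_n S r)"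
      using psi by (rule t_psi_measurable) simp
    have "ennreal c * of_nat r * (\<integral>\<^sup>+ x. ennreal (t_psi \<psi> r x) * mix_dens S r x \<partial>mu_n S r)
        = (\<integral>\<^sup>+ x. ennreal (t_psi \<psi> r x) * (ennreal c * of_nat r * mix_dens S r x) \<partial>mu_n S r)"
      by (subst nn_integral_cmult[symmetric]) (auto simp: mult_ac)
    also have "\<dots> \<le> (\<integral>\<^sup>+ x. ennreal (t_psi \<psi> r x) * (ennreal c * of_nat r * mix_dens S r x
        + min (bayes_loss S r x) (Q_lim S c r x)) \<partial>mu_n S r)"
      by (intro nn_integral_mono mult_left_mono) auto
    also have "\<dots> \<le> opt_value c"
      by (rule order_trans[OF _ stage[OF r]]) (rule add_increasing[OF zero_le order_refl])
    finally show "ennreal c * of_nat r * (\<integral>\<^sup>+ x. ennreal (t_psi \<psi> r x) * mix_dens S r x \<partial>mu_n S r) \<le> opt_value c" .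
  qed
  then have "risk S c \<psi> = (\<Sum>n. ?J (Suc n))"
    by (simp add: risk_def)
  also have "\<dots> \<le> opt_value c"
  proof (rule suminf_le_const)
    fix r
    have "(\<Sum>n<r. ?J (Suc n)) = (\<Sum>n\<in>{1..<Suc r}. ?J n)"
      by (simp only: lessThan_atLeast0 One_nat_def sum.atLeast_Suc_lessThan_Suc_shift o_def)
    also have "\<dots> \<le> opt_value c"
      using stage[of "Suc r"] by (rule order_trans[rotated]) simp_all
    finally show "(\<Sum>n<r. ?J (Suc n)) \<le> opt_value c" .
  qed simp
  finally show ?thesis .
qed

end

theorem theorem5:
  fixes S :: "('t, 'o, 'x, 'd) seq_problem"
    and c :: real
    and \<psi> :: "nat \<Rightarrow> (nat \<Rightarrow> 'x) \<Rightarrow> real"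
  assumes "bayes_seq_problem S"
    and "c > 0"
    and "truncatable_problem S c"
    and "\<psi> \<in> stopping_rules S"
  shows "risk S c \<psi> = (INF \<psi>'\<in>stopping_rules S. risk S c \<psi>') \<longleftrightarrow>
    (\<forall>n\<ge>1. AE x in mu_n S n. x \<in> T_psi S \<psi> n \<longrightarrow>
       indicator {x. bayes_loss S n x < Q_lim S c n x} x \<le> \<psi> n x \<and>
       \<psi> n x \<le> indicator {x. bayes_loss S n x \<le> Q_lim S c n x} x)"
    (is "?opt \<longleftrightarrow> ?threshold")
proof -
  interpret bayes_seq_problem S by fact
  note INF = INF_risk_eq_opt_value[OF assms(3)]
  show ?thesis
  proof
    assume ?opt
    then show ?threshold
      unfolding INF using optimal_imp_threshold[OF assms(4,3)] by blast
  next
    assume ?threshold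
    then have "risk S c \<psi> \<le> opt_value c"
      by (intro threshold_imp_risk_le assms) blast
    then show ?opt
      unfolding INF using opt_value_le_risk[OF assms(3,4)] by (rule antisym)
  qed
qed

end
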